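(* Let $\mathcal B$ be a bicategory, and let $X\in\mathcal B(a,b)$, $Y\in\mathcal B(b,a)$. (i) An adjunction $X\dashv Y$ in $\mathcal B$, with adjunction maps $\tilde\varepsilon:X\otimes Y\to I_b$ and $\tilde\eta:I_a\to Y\otimes X$, gives rise to an algebra structure on $Y\otimes X$ (multiplication $1_Y\otimes\tilde\varepsilon\otimes1_X$, unit $\tilde\eta$) and to a coalgebra structure on $X\otimes Y$ (comultiplication $1_X\otimes\tilde\eta\otimes 1_Y$, counit $\tilde\varepsilon$). (ii) Adjunctions $Y\dashv X\dashv Y$, where $Y\dashv X$ has adjunction maps $\varepsilon:Y\otimes X\to I_a$ and $\eta:I_b\to X\otimes Y$ and $X\dashv Y$ has adjunction maps $\tilde\varepsilon,\tilde\eta$ as in (i), give a Frobenius algebra structure on $A:=Y\otimes X$ (algebra structure from (i) applied to $X\dashv Y$; comultiplication $1_Y\otimes\eta\otimes1_X$ and counit $\varepsilon$). If $\tilde\varepsilon\circ\eta=1_{I_b}$, then $A$ is separable. (iii) If in the situation of (ii) $\tilde\varepsilon\circ\eta\in\mathrm{End}(I_b)$ is invertible, then one can twist the adjunction $Y\dashv X$ by the automorphism $\varphi:=\lambda_X\circ((\tilde\varepsilon\circ\eta)^{-1}\otimes1_X)\circ\lambda_X^{-1}$ of $X$, i.e. replace $\varepsilon,\eta$ by $\varepsilon':=\varepsilon\circ(1_Y\otimes\varphi^{-1})$, $\eta':=(\varphi\otimes1_Y)\circ\eta$. This does not affect the algebra structure on $A=Y\otimes X$, but turns $A$ (with comultiplication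 $1_Y\otimes\eta'\otimes1_X$ and counit $\varepsilon'$) into a separable Frobenius algebra.
   Context: In a bicategory $\mathcal B$ the composite of $X\in\mathcal B(a,b)$ and $Y\in\mathcal B(b,c)$ is written $Y\otimes X\in\mathcal B(a,c)$; $I_a\in\mathcal B(a,a)$ is the unit 1-morphism, $\lambda_X:I_b\otimes X\to X$ is the left unit 2-isomorphism; associators and unitors are otherwise suppressed. An adjunction $P\dashv Q$ for $Q\in\mathcal B(a,b)$, $P\in\mathcal B(b,a)$ consists of 2-morphisms $P\otimes Q\to I_a$ and $I_b\to Q\otimes P$ satisfying the two triangle (zigzag) identities. An algebra in $\mathcal B(a,a)$ is $A$ with associative multiplication $\mu:A\otimes A\to A$ and unit $\eta_A:I_a\to A$; a coalgebra dually has coassociative $\Delta:A\to A\otimes A$ and counit $\varepsilon_A$. An $A$ with both structures is Frobenius if $(1_A\otimes\mu)\circ(\Delta\otimes 1_A)=\Delta\circ\mu=(\mu\otimes 1_A)\circ(1_A\otimes\Delta)$, and separable if $\mu\circ\Delta=1_A$. *)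

theory Defs
  imports Main
begin

text \<open>
  Conventions: \<open>Y \<otimes> X\<close> is the horizontal composite of \<open>X : a \<rightarrow> b\<close> and \<open>Y : b \<rightarrow> c\<close>,
  \<open>g \<star> f\<close> is the horizontal composite of 2-cells (also written with a tensor sign in the
  literature), and \<open>g \<cdot> f\<close> is the vertical composite ``g after f''.  All operations are total
  functions whose values matter only on composable arguments.
\<close>

record ('o, 'm, 'c) bicat =
  Obj :: "'o set"
  Mor :: "'m set"
  Cell :: "'c set"
  src :: "'m \<Rightarrow> 'o"
  trg :: "'m \<Rightarrow> 'o"
  cdom :: "'c \<Rightarrow> 'm"
  ccod :: "'c \<Rightarrow> 'm"
  id2 :: "'m \<Rightarrow> 'c"  ("\<one>\<index> _" [1000] 999)
  vcomp :: "'c \<Rightarrow> 'c \<Rightarrow> 'c"  (infixr "\<cdot>\<index>" 65)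
  unit1 :: "'o \<Rightarrow> 'm"  ("\<I>\<index> _" [1000] 999)
  hcomp1 :: "'m \<Rightarrow> 'm \<Rightarrow> 'm"  (infixr "\<otimes>\<index>" 75)
  hcomp2 :: "'c \<Rightarrow> 'c \<Rightarrow> 'c"  (infixr "\<star>\<index>" 70)
  assoc :: "'m \<Rightarrow> 'm \<Rightarrow> 'm \<Rightarrow> 'c"
  lunit :: "'m \<Rightarrow> 'c"
  runit :: "'m \<Rightarrow> 'c"

definition hom :: "('o, 'm, 'c, 'x) bicat_scheme \<Rightarrow> 'o \<Rightarrow> 'o \<Rightarrow> 'm set" where
  "hom B a b = {X \<in> Mor B. src B X = a \<and> trg B X = b}"

definition cells :: "('o, 'm, 'c, 'x) bicat_scheme \<Rightarrow> 'm \<Rightarrow> 'm \<Rightarrow> 'c set" where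
  "cells B X Y = {f \<in> Cell B. cdom B f = X \<and> ccod B f = Y}"

definition inverse_cells :: "('o, 'm, 'c, 'x) bicat_scheme \<Rightarrow> 'c \<Rightarrow> 'c \<Rightarrow> bool" where
  "inverse_cells B f g \<longleftrightarrow>
     f \<in> Cell B \<and> g \<in> cells B (ccod B f) (cdom B f) \<and>
     g \<cdot>\<^bsub>B\<^esub> f = \<one>\<^bsub>B\<^esub> (cdom B f) \<and> f \<cdot>\<^bsub>B\<^esub> g = \<one>\<^bsub>B\<^esub> (ccod B f)"

definition iso2 :: "('o, 'm, 'c, 'x) bicat_scheme \<Rightarrow> 'c \<Rightarrow> bool" where
  "iso2 B f \<longleftrightarrow> (\<exists>g. inverse_cells B f g)"

definition inv2 :: "('o, 'm, 'c, 'x) bicat_scheme \<Rightarrow> 'c \<Rightarrow> 'c" where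
  "inv2 B f = (THE g. inverse_cells B f g)"

locale bicategory =
  fixes B :: "('o, 'm, 'c, 'x) bicat_scheme" (structure)
  assumes src_trg: "X \<in> Mor B \<Longrightarrow> src B X \<in> Obj B \<and> trg B X \<in> Obj B"
    and dom_cod: "f \<in> Cell B \<Longrightarrow>
      cdom B f \<in> Mor B \<and> ccod B f \<in> Mor B \<and>
      src B (cdom B f) = src B (ccod B f) \<and> trg B (cdom B f) = trg B (ccod B f)"
    \<comment> \<open>hom-categories\<close>
    and id2_cell: "X \<in> Mor B \<Longrightarrow> \<one> X \<in> cells B X X"
    and vcomp_cell: "\<lbrakk>f \<in> cells B X Y; g \<in> cells B Y Z\<rbrakk> \<Longrightarrow> g \<cdot> f \<in> cells B X Z"
    and vcomp_id_left: "f \<in> cells B X Y \<Longrightarrow> \<one> Y \<cdot> f = f"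
    and vcomp_id_right: "f \<in> cells B X Y \<Longrightarrow> f \<cdot> \<one> X = f"
    and vcomp_assoc: "\<lbrakk>f \<in> cells B W X; g \<in> cells B X Y; h \<in> cells B Y Z\<rbrakk> \<Longrightarrow>
      (h \<cdot> g) \<cdot> f = h \<cdot> (g \<cdot> f)"
    \<comment> \<open>units and functorial horizontal composition\<close>
    and unit1_hom: "a \<in> Obj B \<Longrightarrow> \<I> a \<in> hom B a a"
    and hcomp1_hom: "\<lbrakk>X \<in> hom B a b; Y \<in> hom B b c\<rbrakk> \<Longrightarrow> Y \<otimes> X \<in> hom B a c"
    and hcomp2_cell: "\<lbrakk>X \<in> hom B a b; Y \<in> hom B b c; f \<in> cells B X X'; g \<in> cells B Y Y'\<rbrakk> \<Longrightarrow>
      g \<star> f \<in> cells B (Y \<otimes> X) (Y' \<otimes> X')"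
    and hcomp2_id: "\<lbrakk>X \<in> hom B a b; Y \<in> hom B b c\<rbrakk> \<Longrightarrow> \<one> Y \<star> \<one> X = \<one> (Y \<otimes> X)"
    and interchange: "\<lbrakk>X \<in> hom B a b; Y \<in> hom B b c;
        f \<in> cells B X X'; f' \<in> cells B X' X''; g \<in> cells B Y Y'; g' \<in> cells B Y' Y''\<rbrakk> \<Longrightarrow>
      (g' \<cdot> g) \<star> (f' \<cdot> f) = (g' \<star> f') \<cdot> (g \<star> f)"
    \<comment> \<open>associator\<close>
    and assoc_cell: "\<lbrakk>X \<in> hom B a b; Y \<in> hom B b c; Z \<in> hom B c d\<rbrakk> \<Longrightarrow>
      assoc B Z Y X \<in> cells B ((Z \<otimes> Y) \<otimes> X) (Z \<otimes> (Y \<otimes> X))"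
    and assoc_iso: "\<lbrakk>X \<in> hom B a b; Y \<in> hom B b c; Z \<in> hom B c d\<rbrakk> \<Longrightarrow> iso2 B (assoc B Z Y X)"
    and assoc_natural: "\<lbrakk>X \<in> hom B a b; Y \<in> hom B b c; Z \<in> hom B c d;
        f \<in> cells B X X'; g \<in> cells B Y Y'; h \<in> cells B Z Z'\<rbrakk> \<Longrightarrow>
      assoc B Z' Y' X' \<cdot> ((h \<star> g) \<star> f) = (h \<star> (g \<star> f)) \<cdot> assoc B Z Y X"
    \<comment> \<open>unitors\<close>
    and lunit_cell: "X \<in> hom B a b \<Longrightarrow> lunit B X \<in> cells B (\<I> b \<otimes> X) X"
    and lunit_iso: "X \<in> hom B a b \<Longrightarrow> iso2 B (lunit B X)"
    and lunit_natural: "\<lbrakk>X \<in> hom B a b; f \<in> cells B X X'\<rbrakk> \<Longrightarrow>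
      lunit B X' \<cdot> (\<one> (\<I> b) \<star> f) = f \<cdot> lunit B X"
    and runit_cell: "X \<in> hom B a b \<Longrightarrow> runit B X \<in> cells B (X \<otimes> \<I> a) X"
    and runit_iso: "X \<in> hom B a b \<Longrightarrow> iso2 B (runit B X)"
    and runit_natural: "\<lbrakk>X \<in> hom B a b; f \<in> cells B X X'\<rbrakk> \<Longrightarrow>
      runit B X' \<cdot> (f \<star> \<one> (\<I> a)) = f \<cdot> runit B X"
    \<comment> \<open>coherence\<close>
    and pentagon: "\<lbrakk>W \<in> hom B a b; X \<in> hom B b c; Y \<in> hom B c d; Z \<in> hom B d e\<rbrakk> \<Longrightarrow>
      assoc B Z Y (X \<otimes> W) \<cdot> assoc B (Z \<otimes> Y) X W =
      (\<one> Z \<star> assoc B Y X W) \<cdot> assoc B Z (Y \<otimes> X) W \<cdot> (assoc B Z Y X \<star> \<one> W)"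
    and triangle: "\<lbrakk>X \<in> hom B a b; Y \<in> hom B b c\<rbrakk> \<Longrightarrow>
      (\<one> Y \<star> lunit B X) \<cdot> assoc B Y (\<I> b) X = runit B Y \<star> \<one> X"

text \<open>
  \<open>adjunction B a b P Q \<epsilon> \<eta>\<close>: the adjunction \<open>P \<stileturn> Q\<close> for \<open>Q : a \<rightarrow> b\<close> and \<open>P : b \<rightarrow> a\<close>, with
  the coherence cells that make the two zigzag identities well typed.
\<close>
definition adjunction ::
  "('o, 'm, 'c, 'x) bicat_scheme \<Rightarrow> 'o \<Rightarrow> 'o \<Rightarrow> 'm \<Rightarrow> 'm \<Rightarrow> 'c \<Rightarrow> 'c \<Rightarrow> bool" where
  "adjunction B a b P Q \<epsilon> \<eta> \<longleftrightarrow>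
     Q \<in> hom B a b \<and> P \<in> hom B b a \<and>
     \<epsilon> \<in> cells B (P \<otimes> Q) (\<I> a) \<and> \<eta> \<in> cells B (\<I> b) (Q \<otimes> P) \<and>
     lunit B P \<cdot> (\<epsilon> \<star> \<one> P) \<cdot> inv2 B (assoc B P Q P) \<cdot> (\<one> P \<star> \<eta>) \<cdot> inv2 B (runit B P) = \<one> P \<and>
     runit B Q \<cdot> (\<one> Q \<star> \<epsilon>) \<cdot> assoc B Q P Q \<cdot> (\<eta> \<star> \<one> Q) \<cdot> inv2 B (lunit B Q) = \<one> Q"
  for B (structure)

definition algebra_on ::
  "('o, 'm, 'c, 'x) bicat_scheme \<Rightarrow> 'o \<Rightarrow> 'm \<Rightarrow> 'c \<Rightarrow> 'c \<Rightarrow> bool" where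
  "algebra_on B a A \<mu> \<eta> \<longleftrightarrow>
     A \<in> hom B a a \<and> \<mu> \<in> cells B (A \<otimes> A) A \<and> \<eta> \<in> cells B (\<I> a) A \<and>
     \<mu> \<cdot> (\<mu> \<star> \<one> A) = \<mu> \<cdot> (\<one> A \<star> \<mu>) \<cdot> assoc B A A A \<and>
     \<mu> \<cdot> (\<eta> \<star> \<one> A) = lunit B A \<and>
     \<mu> \<cdot> (\<one> A \<star> \<eta>) = runit B A"
  for B (structure)

definition coalgebra_on ::
  "('o, 'm, 'c, 'x) bicat_scheme \<Rightarrow> 'o \<Rightarrow> 'm \<Rightarrow> 'c \<Rightarrow> 'c \<Rightarrow> bool" where
  "coalgebra_on B a A \<Delta> \<epsilon> \<longleftrightarrow>
     A \<in> hom B a a \<and> \<Delta> \<in> cells B A (A \<otimes> A) \<and> \<epsilon> \<in> cells B A (\<I> a) \<and>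
     assoc B A A A \<cdot> (\<Delta> \<star> \<one> A) \<cdot> \<Delta> = (\<one> A \<star> \<Delta>) \<cdot> \<Delta> \<and>
     (\<epsilon> \<star> \<one> A) \<cdot> \<Delta> = inv2 B (lunit B A) \<and>
     (\<one> A \<star> \<epsilon>) \<cdot> \<Delta> = inv2 B (runit B A)"
  for B (structure)

definition frobenius_algebra ::
  "('o, 'm, 'c, 'x) bicat_scheme \<Rightarrow> 'o \<Rightarrow> 'm \<Rightarrow> 'c \<Rightarrow> 'c \<Rightarrow> 'c \<Rightarrow> 'c \<Rightarrow> bool" where
  "frobenius_algebra B a A \<mu> \<eta> \<Delta> \<epsilon> \<longleftrightarrow>
     algebra_on B a A \<mu> \<eta> \<and> coalgebra_on B a A \<Delta> \<epsilon> \<and>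
     (\<one> A \<star> \<mu>) \<cdot> assoc B A A A \<cdot> (\<Delta> \<star> \<one> A) = \<Delta> \<cdot> \<mu> \<and>
     \<Delta> \<cdot> \<mu> = (\<mu> \<star> \<one> A) \<cdot> inv2 B (assoc B A A A) \<cdot> (\<one> A \<star> \<Delta>)"
  for B (structure)

definition separable :: "('o, 'm, 'c, 'x) bicat_scheme \<Rightarrow> 'm \<Rightarrow> 'c \<Rightarrow> 'c \<Rightarrow> bool" where
  "separable B A \<mu> \<Delta> \<longleftrightarrow> \<mu> \<cdot> \<Delta> = \<one> A"
  for B (structure)

text \<open>
  For \<open>e : P \<otimes> Q \<Rightarrow> \<I> b\<close>, \<open>insert_counit B P Q e\<close> is the 2-cell \<open>1_Q \<otimes> e \<otimes> 1_P\<close> from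
  \<open>(Q \<otimes> P) \<otimes> (Q \<otimes> P)\<close> to \<open>Q \<otimes> P\<close>, i.e. the composite
  \<open>(Q \<otimes> P) \<otimes> (Q \<otimes> P) \<Rightarrow> Q \<otimes> (P \<otimes> (Q \<otimes> P)) \<Rightarrow> Q \<otimes> ((P \<otimes> Q) \<otimes> P) \<Rightarrow> Q \<otimes> (\<I> b \<otimes> P) \<Rightarrow> Q \<otimes> P\<close>.
\<close>
definition insert_counit ::
  "('o, 'm, 'c, 'x) bicat_scheme \<Rightarrow> 'm \<Rightarrow> 'm \<Rightarrow> 'c \<Rightarrow> 'c" where
  "insert_counit B P Q e =
     (\<one> Q \<star> lunit B P) \<cdot> (\<one> Q \<star> (e \<star> \<one> P)) \<cdot> (\<one> Q \<star> inv2 B (assoc B P Q P)) \<cdot>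
     assoc B Q P (Q \<otimes> P)"
  for B (structure)

text \<open>
  For \<open>n : \<I> b \<Rightarrow> Q \<otimes> P\<close>, \<open>insert_unit B P Q n\<close> is the 2-cell \<open>1_P \<otimes> n \<otimes> 1_Q\<close> from
  \<open>P \<otimes> Q\<close> to \<open>(P \<otimes> Q) \<otimes> (P \<otimes> Q)\<close>, i.e. the composite
  \<open>P \<otimes> Q \<Rightarrow> P \<otimes> (\<I> b \<otimes> Q) \<Rightarrow> P \<otimes> ((Q \<otimes> P) \<otimes> Q) \<Rightarrow> P \<otimes> (Q \<otimes> (P \<otimes> Q)) \<Rightarrow> (P \<otimes> Q) \<otimes> (P \<otimes> Q)\<close>.
\<close>
definition insert_unit ::
  "('o, 'm, 'c, 'x) bicat_scheme \<Rightarrow> 'm \<Rightarrow> 'm \<Rightarrow> 'c \<Rightarrow> 'c" where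
  "insert_unit B P Q n =
     inv2 B (assoc B P Q (P \<otimes> Q)) \<cdot> (\<one> P \<star> assoc B Q P Q) \<cdot> (\<one> P \<star> (n \<star> \<one> Q)) \<cdot>
     (\<one> P \<star> inv2 B (lunit B Q))"
  for B (structure)

end

theory Submission imports Defs begin

text \<open>
  Write \<open>A = Y \<otimes> X\<close>.  A 2-cell \<open>e : X \<otimes> Y \<Rightarrow> \<I> b\<close> induces a family
  \<open>counit_at Z : X \<otimes> (Y \<otimes> Z) \<Rightarrow> Z\<close>, and hence an ``action''
  \<open>act Z : A \<otimes> (Y \<otimes> Z) \<Rightarrow> Y \<otimes> Z\<close>, whose instance at \<open>Z = X\<close> is the multiplication
  \<open>1 \<otimes> e \<otimes> 1\<close> of \<open>A\<close>.  These families are natural in \<open>Z\<close> (\<open>act_natural\<close>), and up to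
  associators the member at \<open>Z \<otimes> W\<close> is the member at \<open>Z\<close> whiskered with \<open>W\<close>
  (\<open>act_hcomp\<close>), by the pentagon.  From these two properties, associativity (\<open>act_act\<close>) and
  the Frobenius law (\<open>frobenius_left\<close>) follow by the interchange argument that one would give
  in a strict 2-category, since both say that cells acting on different tensor factors commute.
  The two zigzag identities give the two unit laws (\<open>algebra_on_insert_counit\<close>).

  Everything about comultiplications is obtained by reversing 2-cells.  The dual bicategory
  \<open>co B\<close> turns an adjunction \<open>P \<stileturn> Q\<close> into \<open>Q \<stileturn> P\<close>, a multiplication built from a counit into
  a comultiplication built from a unit, and one Frobenius identity into the other.

  Separability is immediate: the two associators between \<open>\<Delta>\<close> and \<open>\<mu>\<close> cancel, and
  \<open>\<mu> \<cdot> \<Delta>\<close> is \<open>e \<cdot> n\<close> inserted between \<open>Y\<close> and \<open>X\<close>.  For the twist, \<open>\<phi>\<close> is the action on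
  \<open>X\<close> of the scalar \<open>t = (e \<cdot> n)\<^sup>-\<^sup>1\<close>, and an adjunction may be transported along any
  isomorphism (\<open>adjunction_transport\<close>).  Scalars act naturally, so \<open>t\<close> can be moved past
  \<open>e\<close>, where it multiplies \<open>e \<cdot> n\<close> to the identity (\<open>scalar_twist\<close>).  At the unit 1-cell
  this uses that the left and right unitors of \<open>\<I> b\<close> agree.
\<close>

section \<open>Calculus of 2-cells\<close>

text \<open>
  The axioms are restated with their typing conditions as equations between sources and targets.
  Such conditions mention only the cells involved, so the simplifier can discharge them without
  having to guess intermediate objects or 1-cells.
\<close>

context bicategory
begin

lemma homI [simp, intro]: "\<lbrakk>X \<in> Mor B; src B X = a; trg B X = b\<rbrakk> \<Longrightarrow> X \<in> hom B a b"
  by (simp add: hom_def)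

lemma cellsI [simp, intro]: "\<lbrakk>f \<in> Cell B; cdom B f = X; ccod B f = Y\<rbrakk> \<Longrightarrow> f \<in> cells B X Y"
  by (simp add: cells_def)

lemma Obj_src_trg [simp]:
  assumes "X \<in> Mor B"
  shows "src B X \<in> Obj B" "trg B X \<in> Obj B"
  using src_trg[OF assms] by auto

lemma Mor_dom_cod [simp]:
  assumes "f \<in> Cell B"
  shows "cdom B f \<in> Mor B" "ccod B f \<in> Mor B"
    "src B (ccod B f) = src B (cdom B f)" "trg B (ccod B f) = trg B (cdom B f)"
  using dom_cod[OF assms] by auto

lemma id2_simps [simp]:
  assumes "X \<in> Mor B"
  shows "\<one> X \<in> Cell B" "cdom B (\<one> X) = X" "ccod B (\<one> X) = X"
  using id2_cell[OF assms] by (auto simp: cells_def)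

lemma unit1_simps [simp]:
  assumes "a \<in> Obj B"
  shows "\<I> a \<in> Mor B" "src B (\<I> a) = a" "trg B (\<I> a) = a"
  using unit1_hom[OF assms] by (auto simp: hom_def)

lemma hcomp1_simps [simp]:
  assumes "X \<in> Mor B" "Y \<in> Mor B" "src B Y = trg B X"
  shows "Y \<otimes> X \<in> Mor B" "src B (Y \<otimes> X) = src B X" "trg B (Y \<otimes> X) = trg B Y"
  using hcomp1_hom[of X "src B X" "trg B X" Y "trg B Y"] assms by (auto simp: hom_def)

lemma vcomp_simps [simp]:
  assumes "f \<in> Cell B" "g \<in> Cell B" "cdom B g = ccod B f"
  shows "g \<cdot> f \<in> Cell B" "cdom B (g \<cdot> f) = cdom B f" "ccod B (g \<cdot> f) = ccod B g"
  using vcomp_cell[of f "cdom B f" "ccod B f" g "ccod B g"] assms by (auto simp: cells_def)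

lemma hcomp2_simps [simp]:
  assumes "f \<in> Cell B" "g \<in> Cell B" "src B (cdom B g) = trg B (cdom B f)"
  shows "g \<star> f \<in> Cell B" "cdom B (g \<star> f) = cdom B g \<otimes> cdom B f"
    "ccod B (g \<star> f) = ccod B g \<otimes> ccod B f"
  using hcomp2_cell[of "cdom B f" "src B (cdom B f)" "trg B (cdom B f)" "cdom B g"
      "trg B (cdom B g)" f "ccod B f" g "ccod B g"] assms
  by (auto simp: cells_def)

lemma vcomp_id [simp]:
  assumes "f \<in> Cell B"
  shows "ccod B f = Y \<Longrightarrow> \<one> Y \<cdot> f = f" "cdom B f = X \<Longrightarrow> f \<cdot> \<one> X = f"
  using assms by (auto intro: vcomp_id_left vcomp_id_right)

lemma vcomp_assoc' [simp]:
  "\<lbrakk>f \<in> Cell B; g \<in> Cell B; h \<in> Cell B; cdom B g = ccod B f; cdom B h = ccod B g\<rbrakk> \<Longrightarrow>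
    (h \<cdot> g) \<cdot> f = h \<cdot> (g \<cdot> f)"
  by (rule vcomp_assoc) auto

lemma hcomp_id [simp]:
  "\<lbrakk>X \<in> Mor B; Y \<in> Mor B; src B Y = trg B X\<rbrakk> \<Longrightarrow> \<one> Y \<star> \<one> X = \<one> (Y \<otimes> X)"
  by (rule hcomp2_id) auto

lemma hcomp_vcomp:
  "\<lbrakk>f \<in> Cell B; f' \<in> Cell B; g \<in> Cell B; g' \<in> Cell B; cdom B f' = ccod B f;
    cdom B g' = ccod B g; src B (cdom B g) = trg B (cdom B f)\<rbrakk> \<Longrightarrow>
    (g' \<star> f') \<cdot> (g \<star> f) = (g' \<cdot> g) \<star> (f' \<cdot> f)"
  by (rule interchange[symmetric]) auto

text \<open>
  Composites are kept associated to the right; this form rewrites a pair of cells that sits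
  at the front of a longer composite.
\<close>

lemma vcomp_extend:
  "\<lbrakk>g \<cdot> f = g' \<cdot> f'; f \<in> Cell B; g \<in> Cell B; cdom B g = ccod B f; f' \<in> Cell B; g' \<in> Cell B;
    cdom B g' = ccod B f'; h \<in> Cell B; cdom B f = ccod B h; cdom B f' = ccod B h\<rbrakk> \<Longrightarrow>
    g \<cdot> (f \<cdot> h) = g' \<cdot> (f' \<cdot> h)"
  by (metis vcomp_assoc')

lemma inverse_cells_unique:
  assumes "inverse_cells B f g" "inverse_cells B f h"
  shows "g = h"
proof -
  have [simp]: "f \<in> Cell B" "g \<in> Cell B" "h \<in> Cell B" "cdom B g = ccod B f" "ccod B g = cdom B f"
     "cdom B h = ccod B f" "ccod B h = cdom B f"
    and e: "g \<cdot> f = \<one> (cdom B f)" "f \<cdot> h = \<one> (ccod B f)"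
    using assms by (auto simp: inverse_cells_def cells_def)
  have "g = g \<cdot> (f \<cdot> h)" by (simp add: e)
  also have "\<dots> = (g \<cdot> f) \<cdot> h" by simp
  also have "\<dots> = h" by (simp add: e)
  finally show ?thesis .
qed

lemma inv2_eqI: "inverse_cells B f g \<Longrightarrow> inv2 B f = g"
  unfolding inv2_def using inverse_cells_unique by blast

lemma inverse_cells_inv2: "iso2 B f \<Longrightarrow> inverse_cells B f (inv2 B f)"
  using inv2_eqI by (metis iso2_def)

lemma iso2_Cell: "iso2 B f \<Longrightarrow> f \<in> Cell B"
  by (auto simp: iso2_def inverse_cells_def)

lemma inv2_simps [simp]:
  assumes "iso2 B f"
  shows "inv2 B f \<in> Cell B" "cdom B (inv2 B f) = ccod B f" "ccod B (inv2 B f) = cdom B f"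
    "inv2 B f \<cdot> f = \<one> (cdom B f)" "f \<cdot> inv2 B f = \<one> (ccod B f)"
  using inverse_cells_inv2[OF assms] by (auto simp: inverse_cells_def cells_def)

lemma inv2_cancel [simp]:
  assumes "iso2 B f" "g \<in> Cell B"
  shows "ccod B g = cdom B f \<Longrightarrow> inv2 B f \<cdot> (f \<cdot> g) = g"
    "ccod B g = ccod B f \<Longrightarrow> f \<cdot> (inv2 B f \<cdot> g) = g"
proof -
  have [simp]: "f \<in> Cell B" using assms iso2_Cell by auto
  show "ccod B g = cdom B f \<Longrightarrow> inv2 B f \<cdot> (f \<cdot> g) = g"
    using assms vcomp_assoc'[of g f "inv2 B f"] by simp
  show "ccod B g = ccod B f \<Longrightarrow> f \<cdot> (inv2 B f \<cdot> g) = g"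
    using assms vcomp_assoc'[of g "inv2 B f" f] by simp
qed

lemma iso2I:
  assumes "f \<in> Cell B" "g \<in> Cell B" "cdom B g = ccod B f" "ccod B g = cdom B f"
    "g \<cdot> f = \<one> (cdom B f)" "f \<cdot> g = \<one> (ccod B f)"
  shows "iso2 B f" "inv2 B f = g"
proof -
  have "inverse_cells B f g" using assms by (simp add: inverse_cells_def)
  then show "iso2 B f" "inv2 B f = g" using inv2_eqI by (auto simp: iso2_def)
qed

lemma iso2_inv2 [simp]:
  assumes "iso2 B f"
  shows "iso2 B (inv2 B f)" "inv2 B (inv2 B f) = f"
  using iso2I[of "inv2 B f" f] assms iso2_Cell by auto

lemma iso2_id2 [simp]:
  assumes "X \<in> Mor B"
  shows "iso2 B (\<one> X)" "inv2 B (\<one> X) = \<one> X"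
  using iso2I[of "\<one> X" "\<one> X"] assms by auto

lemma iso2_vcomp [simp]:
  assumes "iso2 B f" "iso2 B g" "cdom B g = ccod B f"
  shows "iso2 B (g \<cdot> f)" "inv2 B (g \<cdot> f) = inv2 B f \<cdot> inv2 B g"
  using iso2I[of "g \<cdot> f" "inv2 B f \<cdot> inv2 B g"] assms iso2_Cell by auto

lemma iso2_hcomp [simp]:
  assumes "iso2 B f" "iso2 B g" "src B (cdom B g) = trg B (cdom B f)"
  shows "iso2 B (g \<star> f)" "inv2 B (g \<star> f) = inv2 B g \<star> inv2 B f"
proof -
  have [simp]: "f \<in> Cell B" "g \<in> Cell B" using assms iso2_Cell by auto
  show "iso2 B (g \<star> f)" "inv2 B (g \<star> f) = inv2 B g \<star> inv2 B f"
    using iso2I[of "g \<star> f" "inv2 B g \<star> inv2 B f"] assms by (auto simp: hcomp_vcomp)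
qed

lemma whisker_inv2_cancel [simp]:
  assumes "iso2 B f" "Z \<in> Mor B" "src B Z = trg B (cdom B f)" "g \<in> Cell B"
  shows "ccod B g = Z \<otimes> ccod B f \<Longrightarrow> (\<one> Z \<star> f) \<cdot> ((\<one> Z \<star> inv2 B f) \<cdot> g) = g"
    "ccod B g = Z \<otimes> cdom B f \<Longrightarrow> (\<one> Z \<star> inv2 B f) \<cdot> ((\<one> Z \<star> f) \<cdot> g) = g"
  using inv2_cancel[of "\<one> Z \<star> f" g] assms iso2_Cell by simp_all

lemma assoc_simps [simp]:
  assumes "X \<in> Mor B" "Y \<in> Mor B" "Z \<in> Mor B" "src B Y = trg B X" "src B Z = trg B Y"
  shows "assoc B Z Y X \<in> Cell B" "cdom B (assoc B Z Y X) = (Z \<otimes> Y) \<otimes> X"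
    "ccod B (assoc B Z Y X) = Z \<otimes> (Y \<otimes> X)" "iso2 B (assoc B Z Y X)"
  using assoc_cell[of X "src B X" "trg B X" Y "trg B Y" Z "trg B Z"]
    assoc_iso[of X "src B X" "trg B X" Y "trg B Y" Z "trg B Z"] assms
  by (auto simp: cells_def)

lemma lunit_simps [simp]:
  assumes "X \<in> Mor B"
  shows "lunit B X \<in> Cell B" "cdom B (lunit B X) = \<I> (trg B X) \<otimes> X"
    "ccod B (lunit B X) = X" "iso2 B (lunit B X)"
  using lunit_cell[of X "src B X" "trg B X"] lunit_iso[of X "src B X" "trg B X"] assms
  by (auto simp: cells_def)

lemma runit_simps [simp]:
  assumes "X \<in> Mor B"
  shows "runit B X \<in> Cell B" "cdom B (runit B X) = X \<otimes> \<I> (src B X)"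
    "ccod B (runit B X) = X" "iso2 B (runit B X)"
  using runit_cell[of X "src B X" "trg B X"] runit_iso[of X "src B X" "trg B X"] assms
  by (auto simp: cells_def)

lemma assoc_nat:
  "\<lbrakk>f \<in> Cell B; g \<in> Cell B; h \<in> Cell B; src B (cdom B g) = trg B (cdom B f);
    src B (cdom B h) = trg B (cdom B g)\<rbrakk> \<Longrightarrow>
   assoc B (ccod B h) (ccod B g) (ccod B f) \<cdot> ((h \<star> g) \<star> f) =
   (h \<star> (g \<star> f)) \<cdot> assoc B (cdom B h) (cdom B g) (cdom B f)"
  by (rule assoc_natural) auto

lemma lunit_nat:
  "f \<in> Cell B \<Longrightarrow>
    lunit B (ccod B f) \<cdot> (\<one> (\<I> (trg B (cdom B f))) \<star> f) = f \<cdot> lunit B (cdom B f)"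
  by (rule lunit_natural) auto

lemma runit_nat:
  "f \<in> Cell B \<Longrightarrow>
    runit B (ccod B f) \<cdot> (f \<star> \<one> (\<I> (src B (cdom B f)))) = f \<cdot> runit B (cdom B f)"
  by (rule runit_natural) auto

lemma pentagon':
  "\<lbrakk>W \<in> Mor B; X \<in> Mor B; Y \<in> Mor B; Z \<in> Mor B;
    src B X = trg B W; src B Y = trg B X; src B Z = trg B Y\<rbrakk> \<Longrightarrow>
   (\<one> Z \<star> assoc B Y X W) \<cdot> assoc B Z (Y \<otimes> X) W \<cdot> (assoc B Z Y X \<star> \<one> W) =
   assoc B Z Y (X \<otimes> W) \<cdot> assoc B (Z \<otimes> Y) X W"
  by (rule pentagon[symmetric]) auto

lemma triangle':
  "\<lbrakk>X \<in> Mor B; Y \<in> Mor B; src B Y = trg B X\<rbrakk> \<Longrightarrow>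
   (\<one> Y \<star> lunit B X) \<cdot> assoc B Y (\<I> (trg B X)) X = runit B Y \<star> \<one> X"
  by (rule triangle) auto

lemma whisker_vcomp:
  assumes "f \<in> Cell B" "g \<in> Cell B" "cdom B g = ccod B f" "Z \<in> Mor B"
  shows "src B Z = trg B (cdom B f) \<Longrightarrow> \<one> Z \<star> (g \<cdot> f) = (\<one> Z \<star> g) \<cdot> (\<one> Z \<star> f)"
    and "trg B Z = src B (cdom B f) \<Longrightarrow> (g \<cdot> f) \<star> \<one> Z = (g \<star> \<one> Z) \<cdot> (f \<star> \<one> Z)"
  using assms by (simp_all add: hcomp_vcomp)

lemma iso2_right_cancel:
  assumes "f \<cdot> k = g \<cdot> k" "iso2 B k" "f \<in> Cell B" "g \<in> Cell B" "cdom B f = ccod B k" "cdom B g = ccod B k"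
  shows "f = g"
proof -
  have [simp]: "k \<in> Cell B" using assms iso2_Cell by auto
  have "(f \<cdot> k) \<cdot> inv2 B k = (g \<cdot> k) \<cdot> inv2 B k" by (simp only: assms)
  then show ?thesis using assms(2-) by simp
qed

lemma iso2_left_cancel:
  assumes "k \<cdot> f = k \<cdot> g" "iso2 B k" "f \<in> Cell B" "g \<in> Cell B" "cdom B k = ccod B f" "cdom B k = ccod B g"
  shows "f = g"
  using assms by (metis inv2_cancel(1))

end

section \<open>Coherence of the unitors\<close>

context bicategory
begin

text \<open>
  Whiskering with a unit 1-cell is isomorphic to the identity functor, hence faithful.  So an
  equation may be proved after whiskering it, which makes room for the pentagon and triangle
  axioms; this is Kelly's argument for the remaining triangles.
\<close>

lemma lunit_whisker_cancel:
  assumes "\<one> (\<I> (trg B (cdom B f))) \<star> f = \<one> (\<I> (trg B (cdom B f))) \<star> g" "f \<in> Cell B" "g \<in> Cell B" 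
    "cdom B f = cdom B g" "ccod B f = ccod B g"
  shows "f = g"
  using lunit_nat[of f] lunit_nat[of g] assms
  by - (rule iso2_right_cancel[of f "lunit B (cdom B f)" g], auto)

lemma runit_whisker_cancel:
  assumes "f \<star> \<one> (\<I> (src B (cdom B f))) = g \<star> \<one> (\<I> (src B (cdom B f)))" "f \<in> Cell B" "g \<in> Cell B" 
    "cdom B f = cdom B g" "ccod B f = ccod B g"
  shows "f = g"
  using runit_nat[of f] runit_nat[of g] assms
  by - (rule iso2_right_cancel[of f "runit B (cdom B f)" g], auto)

lemma lunit_hcomp:
  assumes [simp]: "X \<in> Mor B" "Y \<in> Mor B" "src B X = trg B Y"
  shows "lunit B (X \<otimes> Y) \<cdot> assoc B (\<I> (trg B X)) X Y = lunit B X \<star> \<one> Y"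
proof -
  let ?I = "\<I> (trg B X)"
  let ?k = "assoc B ?I (?I \<otimes> X) Y \<cdot> (assoc B ?I ?I X \<star> \<one> Y)"
  have "(\<one> ?I \<star> (lunit B (X \<otimes> Y) \<cdot> assoc B ?I X Y)) \<cdot> ?k
    = (\<one> ?I \<star> lunit B (X \<otimes> Y)) \<cdot> ((\<one> ?I \<star> assoc B ?I X Y) \<cdot> ?k)"
    by (simp add: whisker_vcomp)
  also have "\<dots> = (\<one> ?I \<star> lunit B (X \<otimes> Y)) \<cdot> (assoc B ?I ?I (X \<otimes> Y) \<cdot> assoc B (?I \<otimes> ?I) X Y)"
    by (simp add: pentagon')
  also have "\<dots> = ((\<one> ?I \<star> lunit B (X \<otimes> Y)) \<cdot> assoc B ?I ?I (X \<otimes> Y)) \<cdot> assoc B (?I \<otimes> ?I) X Y"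
    by simp
  also have "\<dots> = (runit B ?I \<star> \<one> (X \<otimes> Y)) \<cdot> assoc B (?I \<otimes> ?I) X Y"
    using triangle'[of "X \<otimes> Y" ?I] by simp
  also have "\<dots> = assoc B ?I X Y \<cdot> ((runit B ?I \<star> \<one> X) \<star> \<one> Y)"
    using assoc_nat[of "\<one> Y" "\<one> X" "runit B ?I"] by simp
  also have "\<dots> = assoc B ?I X Y \<cdot> (((\<one> ?I \<star> lunit B X) \<cdot> assoc B ?I ?I X) \<star> \<one> Y)"
    using triangle'[of X ?I] by simp
  also have "\<dots> = (assoc B ?I X Y \<cdot> ((\<one> ?I \<star> lunit B X) \<star> \<one> Y)) \<cdot> (assoc B ?I ?I X \<star> \<one> Y)"
    by (simp add: whisker_vcomp)
  also have "\<dots> = (\<one> ?I \<star> (lunit B X \<star> \<one> Y)) \<cdot> ?k"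
    using assoc_nat[of "\<one> Y" "lunit B X" "\<one> ?I"] by simp
  finally have "\<one> ?I \<star> (lunit B (X \<otimes> Y) \<cdot> assoc B ?I X Y) = \<one> ?I \<star> (lunit B X \<star> \<one> Y)"
    by (rule iso2_right_cancel) auto
  then show ?thesis
    by - (rule lunit_whisker_cancel, auto)
qed

lemma runit_hcomp:
  assumes [simp]: "X \<in> Mor B" "Y \<in> Mor B" "src B X = trg B Y"
  shows "(\<one> X \<star> runit B Y) \<cdot> assoc B X Y (\<I> (src B Y)) = runit B (X \<otimes> Y)"
proof -
  let ?I = "\<I> (src B Y)"
  have "assoc B X Y ?I \<cdot> (runit B (X \<otimes> Y) \<star> \<one> ?I) 
     = (assoc B X Y ?I \<cdot> (\<one> (X \<otimes> Y) \<star> lunit B ?I)) \<cdot> assoc B (X \<otimes> Y) ?I ?I"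
    using triangle'[of ?I "X \<otimes> Y"] by simp
  also have "\<dots> = (\<one> X \<star> (\<one> Y \<star> lunit B ?I)) \<cdot> (assoc B X Y (?I \<otimes> ?I) \<cdot> assoc B (X \<otimes> Y) ?I ?I)"
    using assoc_nat[of "lunit B ?I" "\<one> Y" "\<one> X"] by simp
  also have "\<dots> = (\<one> X \<star> (\<one> Y \<star> lunit B ?I)) \<cdot>
     ((\<one> X \<star> assoc B Y ?I ?I) \<cdot> assoc B X (Y \<otimes> ?I) ?I \<cdot> (assoc B X Y ?I \<star> \<one> ?I))"
    by (simp add: pentagon')
  also have "\<dots> = (\<one> X \<star> ((\<one> Y \<star> lunit B ?I) \<cdot> assoc B Y ?I ?I)) \<cdot> assoc B X (Y \<otimes> ?I) ?I \<cdot> (assoc B X Y ?I \<star> \<one> ?I)"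
    by (simp add: whisker_vcomp)
  also have "\<dots> = ((\<one> X \<star> (runit B Y \<star> \<one> ?I)) \<cdot> assoc B X (Y \<otimes> ?I) ?I) \<cdot> (assoc B X Y ?I \<star> \<one> ?I)"
    using triangle'[of ?I Y] by simp
  also have "\<dots> = assoc B X Y ?I \<cdot> (((\<one> X \<star> runit B Y) \<cdot> assoc B X Y ?I) \<star> \<one> ?I)"
    using assoc_nat[of "\<one> ?I" "runit B Y" "\<one> X"] by (simp add: whisker_vcomp flip: vcomp_assoc')
  finally have "runit B (X \<otimes> Y) \<star> \<one> ?I = ((\<one> X \<star> runit B Y) \<cdot> assoc B X Y ?I) \<star> \<one> ?I"
    by (rule iso2_left_cancel) auto
  then show ?thesis
    by - (rule runit_whisker_cancel[symmetric], auto)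
qed

text \<open>
  Both unitors become equal after whiskering: naturality identifies \<open>lunit (\<I> a \<otimes> \<I> a)\<close>
  with \<open>\<one> (\<I> a) \<star> lunit (\<I> a)\<close>, to which one triangle and the triangle axiom apply.
\<close>

lemma lunit_eq_runit:
  assumes [simp]: "a \<in> Obj B"
  shows "lunit B (\<I> a) = runit B (\<I> a)"
proof -
  let ?I = "\<I> a"
  have "lunit B (?I \<otimes> ?I) = \<one> ?I \<star> lunit B ?I"
    using lunit_nat[of "lunit B ?I"] by - (rule iso2_left_cancel[of "lunit B ?I"], auto)
  then have "lunit B ?I \<star> \<one> ?I = runit B ?I \<star> \<one> ?I"
    using lunit_hcomp[of ?I ?I] triangle'[of ?I ?I] by simp
  then show ?thesis
    by - (rule runit_whisker_cancel, auto)
qed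

end

section \<open>Reversing 2-cells\<close>

text \<open>
  The coherence isomorphisms must be inverted to keep their prescribed direction; horizontal
  structure stays the same.
\<close>

definition co :: "('o, 'm, 'c, 'x) bicat_scheme \<Rightarrow> ('o, 'm, 'c, 'x) bicat_scheme" where
  "co B = B\<lparr>cdom := ccod B, ccod := cdom B, vcomp := (\<lambda>g f. vcomp B f g),
     assoc := (\<lambda>Z Y X. inv2 B (assoc B Z Y X)),
     lunit := (\<lambda>X. inv2 B (lunit B X)), runit := (\<lambda>X. inv2 B (runit B X))\<rparr>"

lemma co_simps [simp]:
  "Obj (co B) = Obj B" "Mor (co B) = Mor B" "Cell (co B) = Cell B"
  "src (co B) = src B" "trg (co B) = trg B" "cdom (co B) = ccod B" "ccod (co B) = cdom B"
  "id2 (co B) = id2 B" "vcomp (co B) g f = vcomp B f g" "unit1 (co B) = unit1 B"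
  "hcomp1 (co B) = hcomp1 B" "hcomp2 (co B) = hcomp2 B"
  "assoc (co B) Z Y X = inv2 B (assoc B Z Y X)"
  "lunit (co B) X = inv2 B (lunit B X)" "runit (co B) X = inv2 B (runit B X)"
  by (simp_all add: co_def)

lemma hom_co [simp]: "hom (co B) = hom B"
  by (simp add: hom_def fun_eq_iff)

lemma cells_co [simp]: "cells (co B) X Y = cells B Y X"
  by (auto simp: cells_def)

lemma inverse_cells_co [simp]: "inverse_cells (co B) = inverse_cells B"
  by (auto simp: inverse_cells_def fun_eq_iff)

lemma iso2_co [simp]: "iso2 (co B) = iso2 B"
  by (simp add: iso2_def fun_eq_iff)

lemma inv2_co [simp]: "inv2 (co B) = inv2 B"
  by (simp add: inv2_def fun_eq_iff)

context bicategory
begin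

text \<open>
  Inverting two opposite sides of a commutative square; it yields the naturality of the inverse
  coherence cells.
\<close>

lemma iso2_square_inverse:
  assumes "g \<cdot> f = f' \<cdot> g'" "iso2 B g" "iso2 B g'" "f \<in> Cell B" "f' \<in> Cell B"
    "cdom B g = ccod B f" "cdom B f' = ccod B g'"
  shows "f \<cdot> inv2 B g' = inv2 B g \<cdot> f'"
proof -
  have [simp]: "g \<in> Cell B" "g' \<in> Cell B" using assms iso2_Cell by auto
  have [simp]: "cdom B f = cdom B g'" "ccod B f' = ccod B g"
    using arg_cong[OF assms(1), of "cdom B"] arg_cong[OF assms(1), of "ccod B"] assms(4-) by simp_all
  have "f \<cdot> inv2 B g' = inv2 B g \<cdot> ((g \<cdot> f) \<cdot> inv2 B g')"
    using assms(2-) by simp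
  also have "\<dots> = inv2 B g \<cdot> ((f' \<cdot> g') \<cdot> inv2 B g')"
    by (simp only: assms(1))
  also have "\<dots> = inv2 B g \<cdot> f'"
    using assms(2-) by simp
  finally show ?thesis .
qed

lemma bicategory_co: "bicategory (co B)"
proof
  show "assoc (co B) Z' Y' X' \<cdot>\<^bsub>co B\<^esub> ((h \<star>\<^bsub>co B\<^esub> g) \<star>\<^bsub>co B\<^esub> f) =
      (h \<star>\<^bsub>co B\<^esub> (g \<star>\<^bsub>co B\<^esub> f)) \<cdot>\<^bsub>co B\<^esub> assoc (co B) Z Y X"
    if "X \<in> hom (co B) a b" "Y \<in> hom (co B) b c" "Z \<in> hom (co B) c d"
      "f \<in> cells (co B) X X'" "g \<in> cells (co B) Y Y'" "h \<in> cells (co B) Z Z'"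
    for a b c d X Y Z f g h X' Y' Z'
    using that assoc_nat[of f g h]
    by (auto simp: hom_def cells_def intro!: iso2_square_inverse)
  show "lunit (co B) X' \<cdot>\<^bsub>co B\<^esub> (\<one>\<^bsub>co B\<^esub> (\<I>\<^bsub>co B\<^esub> b) \<star>\<^bsub>co B\<^esub> f) = f \<cdot>\<^bsub>co B\<^esub> lunit (co B) X"
    if "X \<in> hom (co B) a b" "f \<in> cells (co B) X X'" for a b X f X'
    using that lunit_nat[of f]
    by (auto simp: hom_def cells_def intro!: iso2_square_inverse)
  show "runit (co B) X' \<cdot>\<^bsub>co B\<^esub> (f \<star>\<^bsub>co B\<^esub> \<one>\<^bsub>co B\<^esub> (\<I>\<^bsub>co B\<^esub> a)) = f \<cdot>\<^bsub>co B\<^esub> runit (co B) X"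
    if "X \<in> hom (co B) a b" "f \<in> cells (co B) X X'" for a b X f X'
    using that runit_nat[of f]
    by (auto simp: hom_def cells_def intro!: iso2_square_inverse)
  show "assoc (co B) Z Y (X \<otimes>\<^bsub>co B\<^esub> W) \<cdot>\<^bsub>co B\<^esub> assoc (co B) (Z \<otimes>\<^bsub>co B\<^esub> Y) X W =
      (\<one>\<^bsub>co B\<^esub> Z \<star>\<^bsub>co B\<^esub> assoc (co B) Y X W) \<cdot>\<^bsub>co B\<^esub> assoc (co B) Z (Y \<otimes>\<^bsub>co B\<^esub> X) W \<cdot>\<^bsub>co B\<^esub>
        (assoc (co B) Z Y X \<star>\<^bsub>co B\<^esub> \<one>\<^bsub>co B\<^esub> W)"
    if "W \<in> hom (co B) a b" "X \<in> hom (co B) b c" "Y \<in> hom (co B) c d" "Z \<in> hom (co B) d e"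
    for a b c d e W X Y Z
    using that arg_cong[OF pentagon'[of W X Y Z], of "inv2 B"]
    by (auto simp: hom_def)
  show "(\<one>\<^bsub>co B\<^esub> Y \<star>\<^bsub>co B\<^esub> lunit (co B) X) \<cdot>\<^bsub>co B\<^esub> assoc (co B) Y (\<I>\<^bsub>co B\<^esub> b) X =
      runit (co B) Y \<star>\<^bsub>co B\<^esub> \<one>\<^bsub>co B\<^esub> X"
    if "X \<in> hom (co B) a b" "Y \<in> hom (co B) b c" for a b c X Y
    using that arg_cong[OF triangle'[of X Y], of "inv2 B"]
    by (auto simp: hom_def)
  show "(g' \<cdot>\<^bsub>co B\<^esub> g) \<star>\<^bsub>co B\<^esub> (f' \<cdot>\<^bsub>co B\<^esub> f) =
      (g' \<star>\<^bsub>co B\<^esub> f') \<cdot>\<^bsub>co B\<^esub> (g \<star>\<^bsub>co B\<^esub> f)"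
    if "X \<in> hom (co B) a b" "Y \<in> hom (co B) b c" "f \<in> cells (co B) X X'"
      "f' \<in> cells (co B) X' X''" "g \<in> cells (co B) Y Y'" "g' \<in> cells (co B) Y' Y''"
    for a b c X X' X'' Y Y' Y'' f f' g g'
    using that dom_cod[of f] dom_cod[of f'] dom_cod[of g] dom_cod[of g']
    by (auto simp: hom_def cells_def hcomp_vcomp)
qed (auto simp: hom_def cells_def)

end

section \<open>The action induced by a counit\<close>

text \<open>
  When \<open>e\<close> is the counit of \<open>X \<stileturn> Y\<close>, this is the counit at \<open>Z\<close> of the adjunction between
  the functors \<open>X \<otimes> -\<close> and \<open>Y \<otimes> -\<close> on hom-categories.
\<close>

definition counit_at ::
  "('o, 'm, 'c, 'x) bicat_scheme \<Rightarrow> 'm \<Rightarrow> 'm \<Rightarrow> 'c \<Rightarrow> 'm \<Rightarrow> 'c" where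
  "counit_at B X Y e Z = lunit B Z \<cdot> (e \<star> \<one> Z) \<cdot> inv2 B (assoc B X Y Z)"
  for B (structure)

text \<open>
  For \<open>X \<stileturn> Y\<close> this is the structure map of \<open>Y \<otimes> Z\<close> as a left module over \<open>Y \<otimes> X\<close>.
\<close>

definition act ::
  "('o, 'm, 'c, 'x) bicat_scheme \<Rightarrow> 'm \<Rightarrow> 'm \<Rightarrow> 'c \<Rightarrow> 'm \<Rightarrow> 'c" where
  "act B X Y e Z = (\<one> Y \<star> counit_at B X Y e Z) \<cdot> assoc B Y X (Y \<otimes> Z)"
  for B (structure)

text \<open>
  The shapes of a counit and of a unit are fixed separately, so that the same data can be read
  in \<open>co B\<close>, where the two exchange their roles.
\<close>

locale opposed_pair = bicategory B for B :: "('o, 'm, 'c, 'x) bicat_scheme" (structure) +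
  fixes a b :: 'o and X Y :: 'm
  assumes Mor [simp]: "X \<in> Mor B" "Y \<in> Mor B"
    and ends [simp]: "src B X = a" "trg B X = b" "src B Y = b" "trg B Y = a"
begin

lemma ends_Obj [simp]: "a \<in> Obj B" "b \<in> Obj B"
  using Obj_src_trg[OF Mor(1)] by simp_all

end

locale pairing = opposed_pair +
  fixes e :: 'c
  assumes e [simp]: "e \<in> Cell B" "cdom B e = X \<otimes> Y" "ccod B e = \<I> b"
begin

lemma counit_at_simps [simp]:
  assumes "Z \<in> Mor B" "trg B Z = b"
  shows "counit_at B X Y e Z \<in> Cell B" "cdom B (counit_at B X Y e Z) = X \<otimes> (Y \<otimes> Z)"
    "ccod B (counit_at B X Y e Z) = Z"
  using assms by (simp_all add: counit_at_def)

lemma counit_at_assoc: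
  assumes "Z \<in> Mor B" "trg B Z = b"
  shows "counit_at B X Y e Z \<cdot> assoc B X Y Z = lunit B Z \<cdot> (e \<star> \<one> Z)"
  using assms by (simp add: counit_at_def)

lemma counit_at_natural:
  assumes [simp]: "f \<in> Cell B" "trg B (cdom B f) = b"
  shows "counit_at B X Y e (ccod B f) \<cdot> (\<one> X \<star> (\<one> Y \<star> f)) = f \<cdot> counit_at B X Y e (cdom B f)"
proof (rule iso2_right_cancel)
  let ?Z = "cdom B f" and ?W = "ccod B f"
  have "(counit_at B X Y e ?W \<cdot> (\<one> X \<star> (\<one> Y \<star> f))) \<cdot> assoc B X Y ?Z
      = (counit_at B X Y e ?W \<cdot> assoc B X Y ?W) \<cdot> (\<one> (X \<otimes> Y) \<star> f)"
    using assoc_nat[of f "\<one> Y" "\<one> X"] by simp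
  also have "\<dots> = lunit B ?W \<cdot> ((e \<star> \<one> ?W) \<cdot> (\<one> (X \<otimes> Y) \<star> f))"
    by (simp add: counit_at_assoc)
  also have "(e \<star> \<one> ?W) \<cdot> (\<one> (X \<otimes> Y) \<star> f) = (\<one> (\<I> b) \<star> f) \<cdot> (e \<star> \<one> ?Z)"
    by (simp add: hcomp_vcomp)
  also have "lunit B ?W \<cdot> ((\<one> (\<I> b) \<star> f) \<cdot> (e \<star> \<one> ?Z)) = f \<cdot> (lunit B ?Z \<cdot> (e \<star> \<one> ?Z))"
    using vcomp_extend[OF lunit_nat[of f], of "e \<star> \<one> ?Z"] by simp
  also have "\<dots> = (f \<cdot> counit_at B X Y e ?Z) \<cdot> assoc B X Y ?Z"
    by (simp add: counit_at_assoc)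
  finally show "(counit_at B X Y e ?W \<cdot> (\<one> X \<star> (\<one> Y \<star> f))) \<cdot> assoc B X Y ?Z
      = (f \<cdot> counit_at B X Y e ?Z) \<cdot> assoc B X Y ?Z" .
qed auto

text \<open>
  Composing with the remaining associator \<open>assoc B X Y Z \<star> \<one> W\<close> completes a pentagon; what
  is left is naturality of the associator in \<open>e\<close> and the triangle \<open>lunit_hcomp\<close>.
\<close>

lemma counit_at_hcomp:
  assumes [simp]: "Z \<in> Mor B" "W \<in> Mor B" "trg B Z = b" "src B Z = trg B W"
  shows "counit_at B X Y e (Z \<otimes> W) \<cdot> (\<one> X \<star> assoc B Y Z W) \<cdot> assoc B X (Y \<otimes> Z) W
    = counit_at B X Y e Z \<star> \<one> W"
proof (rule iso2_right_cancel)
  let ?k = "assoc B X Y Z \<star> \<one> W"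
  have "(counit_at B X Y e (Z \<otimes> W) \<cdot> (\<one> X \<star> assoc B Y Z W) \<cdot> assoc B X (Y \<otimes> Z) W) \<cdot> ?k
      = (counit_at B X Y e (Z \<otimes> W) \<cdot> assoc B X Y (Z \<otimes> W)) \<cdot> assoc B (X \<otimes> Y) Z W"
    by (simp add: pentagon')
  also have "\<dots> = lunit B (Z \<otimes> W) \<cdot> ((e \<star> \<one> (Z \<otimes> W)) \<cdot> assoc B (X \<otimes> Y) Z W)"
    by (simp add: counit_at_assoc)
  also have "(e \<star> \<one> (Z \<otimes> W)) \<cdot> assoc B (X \<otimes> Y) Z W = assoc B (\<I> b) Z W \<cdot> ((e \<star> \<one> Z) \<star> \<one> W)"
    using assoc_nat[of "\<one> W" "\<one> Z" e] by simp
  also have "lunit B (Z \<otimes> W) \<cdot> \<dots> = (lunit B (Z \<otimes> W) \<cdot> assoc B (\<I> b) Z W) \<cdot> ((e \<star> \<one> Z) \<star> \<one> W)"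
    by simp
  also have "\<dots> = (lunit B Z \<cdot> (e \<star> \<one> Z)) \<star> \<one> W"
    using lunit_hcomp[of Z W] by (simp add: whisker_vcomp)
  also have "\<dots> = (counit_at B X Y e Z \<star> \<one> W) \<cdot> ?k"
    by (simp add: hcomp_vcomp counit_at_assoc)
  finally show "(counit_at B X Y e (Z \<otimes> W) \<cdot> (\<one> X \<star> assoc B Y Z W) \<cdot> assoc B X (Y \<otimes> Z) W) \<cdot> ?k
      = (counit_at B X Y e Z \<star> \<one> W) \<cdot> ?k" .
qed auto

lemma act_simps [simp]:
  assumes "Z \<in> Mor B" "trg B Z = b"
  shows "act B X Y e Z \<in> Cell B" "cdom B (act B X Y e Z) = (Y \<otimes> X) \<otimes> (Y \<otimes> Z)"
    "ccod B (act B X Y e Z) = Y \<otimes> Z"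
  using assms by (simp_all add: act_def)

lemma insert_counit_eq_act: "insert_counit B X Y e = act B X Y e X"
  by (simp add: insert_counit_def act_def counit_at_def whisker_vcomp)

lemma act_natural:
  assumes [simp]: "f \<in> Cell B" "trg B (cdom B f) = b"
  shows "act B X Y e (ccod B f) \<cdot> (\<one> (Y \<otimes> X) \<star> (\<one> Y \<star> f)) = (\<one> Y \<star> f) \<cdot> act B X Y e (cdom B f)"
proof -
  let ?Z = "cdom B f" and ?W = "ccod B f"
  have "act B X Y e ?W \<cdot> (\<one> (Y \<otimes> X) \<star> (\<one> Y \<star> f))
     = (\<one> Y \<star> counit_at B X Y e ?W) \<cdot> (\<one> Y \<star> (\<one> X \<star> (\<one> Y \<star> f))) \<cdot> assoc B Y X (Y \<otimes> ?Z)"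
    using assoc_nat[of "\<one> Y \<star> f" "\<one> X" "\<one> Y"] by (simp add: act_def)
  also have "\<dots> = (\<one> Y \<star> (counit_at B X Y e ?W \<cdot> (\<one> X \<star> (\<one> Y \<star> f)))) \<cdot> assoc B Y X (Y \<otimes> ?Z)"
    by (simp add: whisker_vcomp)
  also have "\<dots> = (\<one> Y \<star> f) \<cdot> act B X Y e ?Z"
    by (simp add: counit_at_natural whisker_vcomp act_def)
  finally show ?thesis .
qed

lemma act_hcomp:
  assumes [simp]: "Z \<in> Mor B" "W \<in> Mor B" "trg B Z = b" "src B Z = trg B W"
  shows "act B X Y e (Z \<otimes> W) \<cdot> (\<one> (Y \<otimes> X) \<star> assoc B Y Z W) \<cdot> assoc B (Y \<otimes> X) (Y \<otimes> Z) W
    = assoc B Y Z W \<cdot> (act B X Y e Z \<star> \<one> W)"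
proof -
  let ?c = "counit_at B X Y e"
  have "act B X Y e (Z \<otimes> W) \<cdot> (\<one> (Y \<otimes> X) \<star> assoc B Y Z W) \<cdot> assoc B (Y \<otimes> X) (Y \<otimes> Z) W
     = (\<one> Y \<star> ?c (Z \<otimes> W)) \<cdot> (assoc B Y X (Y \<otimes> (Z \<otimes> W)) \<cdot> (\<one> (Y \<otimes> X) \<star> assoc B Y Z W)) \<cdot>
        assoc B (Y \<otimes> X) (Y \<otimes> Z) W"
    by (simp add: act_def)
  also have "\<dots> = (\<one> Y \<star> ?c (Z \<otimes> W)) \<cdot> (\<one> Y \<star> (\<one> X \<star> assoc B Y Z W)) \<cdot>
        (assoc B Y X ((Y \<otimes> Z) \<otimes> W) \<cdot> assoc B (Y \<otimes> X) (Y \<otimes> Z) W)"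
    using assoc_nat[of "assoc B Y Z W" "\<one> X" "\<one> Y"] by simp
  also have "\<dots> = (\<one> Y \<star> ?c (Z \<otimes> W)) \<cdot> (\<one> Y \<star> (\<one> X \<star> assoc B Y Z W)) \<cdot>
        ((\<one> Y \<star> assoc B X (Y \<otimes> Z) W) \<cdot> assoc B Y (X \<otimes> (Y \<otimes> Z)) W \<cdot> (assoc B Y X (Y \<otimes> Z) \<star> \<one> W))"
    by (simp add: pentagon')
  also have "\<dots> = (\<one> Y \<star> (?c (Z \<otimes> W) \<cdot> (\<one> X \<star> assoc B Y Z W) \<cdot> assoc B X (Y \<otimes> Z) W)) \<cdot>
        assoc B Y (X \<otimes> (Y \<otimes> Z)) W \<cdot> (assoc B Y X (Y \<otimes> Z) \<star> \<one> W)"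
    by (simp add: whisker_vcomp)
  also have "\<dots> = ((\<one> Y \<star> (?c Z \<star> \<one> W)) \<cdot> assoc B Y (X \<otimes> (Y \<otimes> Z)) W) \<cdot> (assoc B Y X (Y \<otimes> Z) \<star> \<one> W)"
    by (simp add: counit_at_hcomp)
  also have "\<dots> = (assoc B Y Z W \<cdot> ((\<one> Y \<star> ?c Z) \<star> \<one> W)) \<cdot> (assoc B Y X (Y \<otimes> Z) \<star> \<one> W)"
    using assoc_nat[of "\<one> W" "?c Z" "\<one> Y"] by simp
  also have "\<dots> = assoc B Y Z W \<cdot> (act B X Y e Z \<star> \<one> W)"
    by (simp add: act_def whisker_vcomp)
  finally show ?thesis .
qed

text \<open>
  Associativity is naturality of the action with respect to \<open>counit_at Z\<close>.  Up to associators,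
  \<open>act X \<star> \<one> (Y \<otimes> Z)\<close> is the action at \<open>X \<otimes> (Y \<otimes> Z)\<close> by \<open>act_hcomp\<close>, and the \<open>act Z\<close>
  that follows it is \<open>\<one> Y \<star> counit_at Z\<close>, which can therefore be moved in front of it.
\<close>

lemma act_act:
  assumes [simp]: "Z \<in> Mor B" "trg B Z = b"
  shows "act B X Y e Z \<cdot> (act B X Y e X \<star> \<one> (Y \<otimes> Z)) =
     act B X Y e Z \<cdot> (\<one> (Y \<otimes> X) \<star> act B X Y e Z) \<cdot> assoc B (Y \<otimes> X) (Y \<otimes> X) (Y \<otimes> Z)"
proof -
  let ?act = "act B X Y e" and ?A = "Y \<otimes> X" and ?c = "counit_at B X Y e"
  have "?act Z \<cdot> (?act X \<star> \<one> (Y \<otimes> Z))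
      = (\<one> Y \<star> ?c Z) \<cdot> (assoc B Y X (Y \<otimes> Z) \<cdot> (?act X \<star> \<one> (Y \<otimes> Z)))"
    by (simp add: act_def[of B X Y e Z])
  also have "\<dots> = ((\<one> Y \<star> ?c Z) \<cdot> ?act (X \<otimes> (Y \<otimes> Z))) \<cdot> (\<one> ?A \<star> assoc B Y X (Y \<otimes> Z)) \<cdot>
      assoc B ?A ?A (Y \<otimes> Z)"
    by (simp flip: act_hcomp)
  also have "(\<one> Y \<star> ?c Z) \<cdot> ?act (X \<otimes> (Y \<otimes> Z)) = ?act Z \<cdot> (\<one> ?A \<star> (\<one> Y \<star> ?c Z))"
    using act_natural[of "?c Z"] by simp
  also have "(?act Z \<cdot> (\<one> ?A \<star> (\<one> Y \<star> ?c Z))) \<cdot> (\<one> ?A \<star> assoc B Y X (Y \<otimes> Z)) \<cdot> assoc B ?A ?A (Y \<otimes> Z)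
     = ?act Z \<cdot> (\<one> ?A \<star> ?act Z) \<cdot> assoc B ?A ?A (Y \<otimes> Z)"
    by (simp add: act_def[of B X Y e Z] whisker_vcomp)
  finally show ?thesis .
qed

text \<open>
  Each unit law is one zigzag identity.  The first identity, whiskered by \<open>Y\<close> on the left, is the
  right unit law; the second, whiskered by \<open>X\<close> on the right, is the left unit law.
\<close>

lemma algebra_on_insert_counit:
  assumes adj: "adjunction B b a X Y e h"
  shows "algebra_on B a (Y \<otimes> X) (insert_counit B X Y e) h"
proof -
  let ?A = "Y \<otimes> X" and ?c = "counit_at B X Y e"
  have h [simp]: "h \<in> Cell B" "cdom B h = \<I> a" "ccod B h = Y \<otimes> X"
    and z1: "(?c X \<cdot> (\<one> X \<star> h)) \<cdot> inv2 B (runit B X) = \<one> X \<cdot> runit B X \<cdot> inv2 B (runit B X)"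
    and z2: "(runit B Y \<cdot> (\<one> Y \<star> e) \<cdot> assoc B Y X Y \<cdot> (h \<star> \<one> Y)) \<cdot> inv2 B (lunit B Y) =
      lunit B Y \<cdot> inv2 B (lunit B Y)"
    using adj by (auto simp: adjunction_def cells_def counit_at_def)
  have z1: "?c X \<cdot> (\<one> X \<star> h) = runit B X"
    using z1 by - (rule iso2_right_cancel[where k = "inv2 B (runit B X)"], auto)
  have z2: "runit B Y \<cdot> (\<one> Y \<star> e) \<cdot> assoc B Y X Y \<cdot> (h \<star> \<one> Y) = lunit B Y"
    using z2 by (rule iso2_right_cancel) auto
  \<comment> \<open>Composing with this associator separates the factor \<open>X\<close>, so that the zigzag for \<open>Y\<close>
      appears as a whiskered cell.\<close>
  have left: "act B X Y e X \<cdot> (h \<star> \<one> ?A) = lunit B ?A"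
  proof (rule iso2_right_cancel)
    have "(act B X Y e X \<cdot> (h \<star> \<one> ?A)) \<cdot> assoc B (\<I> a) Y X
       = (\<one> Y \<star> ?c X) \<cdot> (assoc B Y X ?A \<cdot> assoc B ?A Y X) \<cdot> ((h \<star> \<one> Y) \<star> \<one> X)"
      using assoc_nat[of "\<one> X" "\<one> Y" h] by (simp add: act_def)
    also have "\<dots> = (\<one> Y \<star> ?c X) \<cdot> ((\<one> Y \<star> assoc B X Y X) \<cdot> assoc B Y (X \<otimes> Y) X \<cdot>
         (assoc B Y X Y \<star> \<one> X)) \<cdot> ((h \<star> \<one> Y) \<star> \<one> X)"
      by (simp add: pentagon')
    also have "\<dots> = (\<one> Y \<star> (?c X \<cdot> assoc B X Y X)) \<cdot> assoc B Y (X \<otimes> Y) X \<cdot>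
         (assoc B Y X Y \<star> \<one> X) \<cdot> ((h \<star> \<one> Y) \<star> \<one> X)"
      by (simp add: whisker_vcomp)
    also have "\<dots> = (\<one> Y \<star> lunit B X) \<cdot> ((\<one> Y \<star> (e \<star> \<one> X)) \<cdot> assoc B Y (X \<otimes> Y) X) \<cdot>
         (assoc B Y X Y \<star> \<one> X) \<cdot> ((h \<star> \<one> Y) \<star> \<one> X)"
      by (simp add: counit_at_assoc whisker_vcomp)
    also have "(\<one> Y \<star> (e \<star> \<one> X)) \<cdot> assoc B Y (X \<otimes> Y) X = assoc B Y (\<I> b) X \<cdot> ((\<one> Y \<star> e) \<star> \<one> X)"
      using assoc_nat[of "\<one> X" e "\<one> Y"] by simp
    also have "(\<one> Y \<star> lunit B X) \<cdot> (assoc B Y (\<I> b) X \<cdot> ((\<one> Y \<star> e) \<star> \<one> X)) \<cdot>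
         (assoc B Y X Y \<star> \<one> X) \<cdot> ((h \<star> \<one> Y) \<star> \<one> X)
       = ((\<one> Y \<star> lunit B X) \<cdot> assoc B Y (\<I> b) X) \<cdot> ((\<one> Y \<star> e) \<star> \<one> X) \<cdot>
         (assoc B Y X Y \<star> \<one> X) \<cdot> ((h \<star> \<one> Y) \<star> \<one> X)"
      by simp
    also have "\<dots> = (runit B Y \<cdot> (\<one> Y \<star> e) \<cdot> assoc B Y X Y \<cdot> (h \<star> \<one> Y)) \<star> \<one> X"
      using triangle'[of X Y] by (simp add: whisker_vcomp)
    also have "\<dots> = lunit B ?A \<cdot> assoc B (\<I> a) Y X"
      using lunit_hcomp[of Y X] by (simp add: z2)
    finally show "(act B X Y e X \<cdot> (h \<star> \<one> ?A)) \<cdot> assoc B (\<I> a) Y X = lunit B ?A \<cdot> assoc B (\<I> a) Y X" .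
  qed auto
  have "act B X Y e X \<cdot> (\<one> ?A \<star> h)
     = (\<one> Y \<star> ?c X) \<cdot> (\<one> Y \<star> (\<one> X \<star> h)) \<cdot> assoc B Y X (\<I> a)"
    using assoc_nat[of h "\<one> X" "\<one> Y"] by (simp add: act_def)
  also have "\<dots> = (\<one> Y \<star> (?c X \<cdot> (\<one> X \<star> h))) \<cdot> assoc B Y X (\<I> a)"
    by (simp add: whisker_vcomp)
  also have "\<dots> = runit B ?A"
    using runit_hcomp[of Y X] by (simp add: z1)
  finally have right: "act B X Y e X \<cdot> (\<one> ?A \<star> h) = runit B ?A" .
  show ?thesis
    using left right act_act[of X] by (simp add: algebra_on_def insert_counit_eq_act)
qed

end

section \<open>Comultiplications by duality\<close>

locale copairing = opposed_pair +
  fixes n :: 'c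
  assumes n [simp]: "n \<in> Cell B" "cdom B n = \<I> b" "ccod B n = X \<otimes> Y"

lemma (in pairing) copairing_co: "copairing (co B) a b X Y e"
proof -
  interpret co: bicategory "co B" by (rule bicategory_co)
  show ?thesis by unfold_locales auto
qed

lemma (in copairing) pairing_co: "pairing (co B) a b X Y n"
proof -
  interpret co: bicategory "co B" by (rule bicategory_co)
  show ?thesis by unfold_locales auto
qed

lemma (in pairing) insert_unit_co: "insert_unit (co B) Y X e = insert_counit B X Y e"
  by (simp add: insert_unit_def insert_counit_def)

lemma (in copairing) insert_counit_co: "insert_counit (co B) X Y n = insert_unit B Y X n"
  by (simp add: insert_unit_def insert_counit_def)

lemma (in bicategory) adjunction_co:
  assumes "adjunction B a b P Q e n"
  shows "adjunction (co B) b a Q P n e"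
proof -
  have "Q \<in> hom B a b" "P \<in> hom B b a" "e \<in> cells B (P \<otimes> Q) (\<I> a)" "n \<in> cells B (\<I> b) (Q \<otimes> P)"
    using assms by (auto simp: adjunction_def)
  then show ?thesis
    using assms by (auto simp: adjunction_def hom_def cells_def)
qed

lemma (in bicategory) pairing_of_adjunction:
  assumes "adjunction B b a X Y e h"
  shows "pairing B a b X Y e"
  using assms by unfold_locales (auto simp: adjunction_def hom_def cells_def)

lemma (in bicategory) copairing_of_adjunction:
  assumes "adjunction B a b Y X e n"
  shows "copairing B a b X Y n"
  using assms by unfold_locales (auto simp: adjunction_def hom_def cells_def)

lemma (in bicategory) algebra_on_co_imp_coalgebra_on:
  assumes "algebra_on (co B) a A d e"
  shows "coalgebra_on B a A d e"
proof -
  have A [simp]: "A \<in> Mor B" "src B A = a" "trg B A = a"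
    and [simp]: "d \<in> Cell B" "cdom B d = A" "ccod B d = A \<otimes> A"
      "e \<in> Cell B" "cdom B e = A" "ccod B e = \<I> a"
    and ass: "(d \<star> \<one> A) \<cdot> d = inv2 B (assoc B A A A) \<cdot> (\<one> A \<star> d) \<cdot> d"
    and un: "(e \<star> \<one> A) \<cdot> d = inv2 B (lunit B A)" "(\<one> A \<star> e) \<cdot> d = inv2 B (runit B A)"
    using assms by (auto simp: algebra_on_def hom_def cells_def)
  have [simp]: "a \<in> Obj B" using Obj_src_trg(1)[OF A(1)] by simp
  show ?thesis
    by (simp add: coalgebra_on_def ass un)
qed

lemma (in bicategory) algebra_on_of_adjunction:
  assumes "adjunction B b a X Y e h"
  shows "algebra_on B a (Y \<otimes> X) (insert_counit B X Y e) h"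
  using pairing.algebra_on_insert_counit[OF pairing_of_adjunction] assms by blast

lemma (in bicategory) coalgebra_on_of_adjunction:
  assumes adj: "adjunction B a b Y X e n"
  shows "coalgebra_on B a (Y \<otimes> X) (insert_unit B Y X n) e"
proof -
  interpret copairing B a b X Y n
    by (rule copairing_of_adjunction[OF adj])
  interpret co: bicategory "co B" by (rule bicategory_co)
  have "algebra_on (co B) a (Y \<otimes> X) (insert_unit B Y X n) e"
    using co.algebra_on_of_adjunction[OF adjunction_co[OF adj]] by (simp add: insert_counit_co)
  then show ?thesis
    by (rule algebra_on_co_imp_coalgebra_on)
qed

section \<open>The Frobenius and separability laws\<close>

locale bipairing = pairing + copairing
begin

lemma bipairing_co: "bipairing (co B) a b X Y n e"
  by (intro bipairing.intro pairing_co copairing_co)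

sublocale dual: pairing "co B" a b X Y n
  by (rule pairing_co)

abbreviation "coact \<equiv> act (co B) X Y n"

lemma insert_unit_eq_coact: "insert_unit B Y X n = coact X"
  using dual.insert_counit_eq_act by (simp add: insert_counit_co)

lemma coact_simps [simp]:
  assumes "Z \<in> Mor B" "trg B Z = b"
  shows "coact Z \<in> Cell B" "cdom B (coact Z) = Y \<otimes> Z"
    "ccod B (coact Z) = (Y \<otimes> X) \<otimes> (Y \<otimes> Z)"
  using dual.act_simps assms by simp_all

lemma coact_natural:
  assumes "f \<in> Cell B" "trg B (cdom B f) = b"
  shows "(\<one> (Y \<otimes> X) \<star> (\<one> Y \<star> f)) \<cdot> coact (cdom B f) = coact (ccod B f) \<cdot> (\<one> Y \<star> f)"
  using dual.act_natural[of f] assms by simp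

lemma coact_hcomp:
  assumes [simp]: "Z \<in> Mor B" "W \<in> Mor B" "trg B Z = b" "src B Z = trg B W"
  shows "coact (Z \<otimes> W) \<cdot> assoc B Y Z W =
    (\<one> (Y \<otimes> X) \<star> assoc B Y Z W) \<cdot> assoc B (Y \<otimes> X) (Y \<otimes> Z) W \<cdot> (coact Z \<star> \<one> W)"
proof -
  let ?k = "(\<one> (Y \<otimes> X) \<star> assoc B Y Z W) \<cdot> assoc B (Y \<otimes> X) (Y \<otimes> Z) W"
  have "inv2 B ?k \<cdot> coact (Z \<otimes> W) = (coact Z \<star> \<one> W) \<cdot> inv2 B (assoc B Y Z W)"
    using dual.act_hcomp[of Z W] by simp
  then have "?k \<cdot> (inv2 B ?k \<cdot> coact (Z \<otimes> W)) \<cdot> assoc B Y Z W =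
      ?k \<cdot> ((coact Z \<star> \<one> W) \<cdot> inv2 B (assoc B Y Z W)) \<cdot> assoc B Y Z W"
    by (simp only:)
  then show ?thesis
    by (simp add: whisker_vcomp)
qed

text \<open>
  This is naturality of the coaction with respect to \<open>counit_at X\<close>: comultiplying on the left
  factor and multiplying on the right one commute by interchange.
\<close>

lemma frobenius_left:
  fixes A defines "A \<equiv> Y \<otimes> X"
  shows "(\<one> A \<star> insert_counit B X Y e) \<cdot> assoc B A A A \<cdot> (insert_unit B Y X n \<star> \<one> A) =
    insert_unit B Y X n \<cdot> insert_counit B X Y e"
proof -
  let ?act = "act B X Y e" and ?c = "counit_at B X Y e"
  have "coact X \<cdot> ?act X = (coact X \<cdot> (\<one> Y \<star> ?c X)) \<cdot> assoc B Y X A"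
    by (simp add: act_def[of B X Y e X] A_def)
  also have "\<dots> = (\<one> A \<star> (\<one> Y \<star> ?c X)) \<cdot> coact (X \<otimes> A) \<cdot> assoc B Y X A"
    using coact_natural[of "?c X"] by (simp add: A_def flip: vcomp_assoc')
  also have "\<dots> = ((\<one> A \<star> (\<one> Y \<star> ?c X)) \<cdot> (\<one> A \<star> assoc B Y X A)) \<cdot> assoc B A A A \<cdot> (coact X \<star> \<one> A)"
    by (simp add: coact_hcomp A_def)
  also have "(\<one> A \<star> (\<one> Y \<star> ?c X)) \<cdot> (\<one> A \<star> assoc B Y X A) = \<one> A \<star> ?act X"
    by (simp add: act_def[of B X Y e X] A_def whisker_vcomp)
  finally show ?thesis
    by (simp add: insert_counit_eq_act insert_unit_eq_coact)
qed

lemma frobenius_right: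
  fixes A defines "A \<equiv> Y \<otimes> X"
  shows "insert_unit B Y X n \<cdot> insert_counit B X Y e =
    (insert_counit B X Y e \<star> \<one> A) \<cdot> inv2 B (assoc B A A A) \<cdot> (\<one> A \<star> insert_unit B Y X n)"
proof -
  interpret co: bipairing "co B" a b X Y n e by (rule bipairing_co)
  show ?thesis
    using co.frobenius_left
    by (simp add: A_def insert_counit_co insert_unit_co insert_counit_eq_act insert_unit_eq_coact)
qed

lemma separable_insert:
  assumes "e \<cdot> n = \<one> (\<I> b)"
  shows "separable B (Y \<otimes> X) (insert_counit B X Y e) (insert_unit B Y X n)"
proof -
  have "insert_counit B X Y e \<cdot> insert_unit B Y X n
    = \<one> Y \<star> (lunit B X \<cdot> ((e \<cdot> n) \<star> \<one> X) \<cdot> inv2 B (lunit B X))"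
    by (simp add: insert_counit_eq_act insert_unit_eq_coact act_def counit_at_def whisker_vcomp)
  then show ?thesis
    by (simp add: assms separable_def)
qed

end

lemma (in bicategory) bipairing_of_adjunctions:
  assumes "adjunction B a b Y X e n" "adjunction B b a X Y e' n'"
  shows "bipairing B a b X Y e' n"
  using assms by (intro bipairing.intro pairing_of_adjunction copairing_of_adjunction)

lemma (in bicategory) frobenius_algebra_of_adjunctions:
  assumes "adjunction B a b Y X e n" "adjunction B b a X Y e' n'"
  shows "frobenius_algebra B a (Y \<otimes> X) (insert_counit B X Y e') n' (insert_unit B Y X n) e"
  unfolding frobenius_algebra_def
  using algebra_on_of_adjunction[OF assms(2)] coalgebra_on_of_adjunction[OF assms(1)]
    bipairing.frobenius_left[OF bipairing_of_adjunctions[OF assms]]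
    bipairing.frobenius_right[OF bipairing_of_adjunctions[OF assms]]
  by (intro conjI)

section \<open>Twisting an adjunction\<close>

text \<open>
  In each zigzag \<open>f\<close> meets its inverse.  In the first, they are adjacent once \<open>f\<close> is moved
  through the associator.  In the second, they end up at the two ends, so that the identity of
  \<open>Q\<close> is conjugated by \<open>f\<close>.
\<close>

lemma (in bicategory) adjunction_transport:
  assumes adj: "adjunction B a b P Q e n" and [simp]: "iso2 B f" "cdom B f = Q" "ccod B f = Q'"
  shows "adjunction B a b P Q' (e \<cdot> (\<one> P \<star> inv2 B f)) ((f \<star> \<one> P) \<cdot> n)"
proof -
  have Q [simp]: "Q \<in> Mor B" "src B Q = a" "trg B Q = b" 
    and [simp]: "P \<in> Mor B" "src B P = b" "trg B P = a"
      "e \<in> Cell B" "cdom B e = P \<otimes> Q" "ccod B e = \<I> a"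
      "n \<in> Cell B" "cdom B n = \<I> b" "ccod B n = Q \<otimes> P"
    and z1: "lunit B P \<cdot> (e \<star> \<one> P) \<cdot> inv2 B (assoc B P Q P) \<cdot> (\<one> P \<star> n) \<cdot> inv2 B (runit B P) = \<one> P"
    and z2: "runit B Q \<cdot> (\<one> Q \<star> e) \<cdot> assoc B Q P Q \<cdot> (n \<star> \<one> Q) \<cdot> inv2 B (lunit B Q) = \<one> Q"
    using adj by (auto simp: adjunction_def hom_def cells_def)
  have [simp]: "a \<in> Obj B" "b \<in> Obj B" using Obj_src_trg[OF Q(1)] by simp_all
  have f [simp]: "f \<in> Cell B" by (simp add: iso2_Cell)
  have Q' [simp]: "Q' \<in> Mor B" "src B Q' = a" "trg B Q' = b"
    using dom_cod[OF f] by simp_all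
  have "lunit B P \<cdot> ((e \<cdot> (\<one> P \<star> inv2 B f)) \<star> \<one> P) \<cdot> inv2 B (assoc B P Q' P) \<cdot>
      (\<one> P \<star> ((f \<star> \<one> P) \<cdot> n)) \<cdot> inv2 B (runit B P)
    = lunit B P \<cdot> (e \<star> \<one> P) \<cdot> ((\<one> P \<star> inv2 B f) \<star> \<one> P) \<cdot>
      (inv2 B (assoc B P Q' P) \<cdot> (\<one> P \<star> (f \<star> \<one> P))) \<cdot> (\<one> P \<star> n) \<cdot> inv2 B (runit B P)"
    by (simp add: whisker_vcomp)
  also have "inv2 B (assoc B P Q' P) \<cdot> (\<one> P \<star> (f \<star> \<one> P)) =
      ((\<one> P \<star> f) \<star> \<one> P) \<cdot> inv2 B (assoc B P Q P)"
    using assoc_nat[of "\<one> P" f "\<one> P"] by (intro iso2_square_inverse[symmetric]) simp_all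
  also have "lunit B P \<cdot> (e \<star> \<one> P) \<cdot> ((\<one> P \<star> inv2 B f) \<star> \<one> P) \<cdot>
      (((\<one> P \<star> f) \<star> \<one> P) \<cdot> inv2 B (assoc B P Q P)) \<cdot> (\<one> P \<star> n) \<cdot> inv2 B (runit B P)
    = lunit B P \<cdot> (e \<star> \<one> P) \<cdot> (((\<one> P \<star> inv2 B f) \<star> \<one> P) \<cdot> ((\<one> P \<star> f) \<star> \<one> P)) \<cdot>
      inv2 B (assoc B P Q P) \<cdot> (\<one> P \<star> n) \<cdot> inv2 B (runit B P)"
    by simp
  also have "\<dots> = \<one> P"
    by (simp add: hcomp_vcomp z1)
  finally have 1: "lunit B P \<cdot> ((e \<cdot> (\<one> P \<star> inv2 B f)) \<star> \<one> P) \<cdot> inv2 B (assoc B P Q' P) \<cdot>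
      (\<one> P \<star> ((f \<star> \<one> P) \<cdot> n)) \<cdot> inv2 B (runit B P) = \<one> P" .
  have slide: "(\<one> (Q' \<otimes> P) \<star> inv2 B f) \<cdot> ((f \<star> \<one> P) \<star> \<one> Q') =
      ((f \<star> \<one> P) \<star> \<one> Q) \<cdot> (\<one> (Q \<otimes> P) \<star> inv2 B f)"
    by (simp add: hcomp_vcomp)
  have "runit B Q' \<cdot> (\<one> Q' \<star> (e \<cdot> (\<one> P \<star> inv2 B f))) \<cdot> assoc B Q' P Q' \<cdot>
      (((f \<star> \<one> P) \<cdot> n) \<star> \<one> Q') \<cdot> inv2 B (lunit B Q')
    = runit B Q' \<cdot> (\<one> Q' \<star> e) \<cdot> ((\<one> Q' \<star> (\<one> P \<star> inv2 B f)) \<cdot> assoc B Q' P Q') \<cdot>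
      ((f \<star> \<one> P) \<star> \<one> Q') \<cdot> (n \<star> \<one> Q') \<cdot> inv2 B (lunit B Q')"
    by (simp add: whisker_vcomp)
  also have "(\<one> Q' \<star> (\<one> P \<star> inv2 B f)) \<cdot> assoc B Q' P Q' = assoc B Q' P Q \<cdot> (\<one> (Q' \<otimes> P) \<star> inv2 B f)"
    using assoc_nat[of "inv2 B f" "\<one> P" "\<one> Q'"] by simp
  also have "runit B Q' \<cdot> (\<one> Q' \<star> e) \<cdot> (assoc B Q' P Q \<cdot> (\<one> (Q' \<otimes> P) \<star> inv2 B f)) \<cdot>
      ((f \<star> \<one> P) \<star> \<one> Q') \<cdot> (n \<star> \<one> Q') \<cdot> inv2 B (lunit B Q')
    = runit B Q' \<cdot> (\<one> Q' \<star> e) \<cdot> assoc B Q' P Q \<cdot> ((f \<star> \<one> P) \<star> \<one> Q) \<cdot> 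
      ((\<one> (Q \<otimes> P) \<star> inv2 B f) \<cdot> (n \<star> \<one> Q')) \<cdot> inv2 B (lunit B Q')"
    using vcomp_extend[OF slide, of "(n \<star> \<one> Q') \<cdot> inv2 B (lunit B Q')"] by simp
  also have "(\<one> (Q \<otimes> P) \<star> inv2 B f) \<cdot> (n \<star> \<one> Q') = (n \<star> \<one> Q) \<cdot> (\<one> (\<I> b) \<star> inv2 B f)"
    by (simp add: hcomp_vcomp)
  also have "runit B Q' \<cdot> (\<one> Q' \<star> e) \<cdot> assoc B Q' P Q \<cdot> ((f \<star> \<one> P) \<star> \<one> Q) \<cdot> 
      ((n \<star> \<one> Q) \<cdot> (\<one> (\<I> b) \<star> inv2 B f)) \<cdot> inv2 B (lunit B Q')
    = runit B Q' \<cdot> (\<one> Q' \<star> e) \<cdot> (assoc B Q' P Q \<cdot> ((f \<star> \<one> P) \<star> \<one> Q)) \<cdot> 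
      (n \<star> \<one> Q) \<cdot> ((\<one> (\<I> b) \<star> inv2 B f) \<cdot> inv2 B (lunit B Q'))"
    by simp
  also have "(\<one> (\<I> b) \<star> inv2 B f) \<cdot> inv2 B (lunit B Q') = inv2 B (lunit B Q) \<cdot> inv2 B f"
    using lunit_nat[of "inv2 B f"] by (intro iso2_square_inverse) simp_all
  also have "assoc B Q' P Q \<cdot> ((f \<star> \<one> P) \<star> \<one> Q) = (f \<star> \<one> (P \<otimes> Q)) \<cdot> assoc B Q P Q"
    using assoc_nat[of "\<one> Q" "\<one> P" f] by simp
  also have "runit B Q' \<cdot> (\<one> Q' \<star> e) \<cdot> ((f \<star> \<one> (P \<otimes> Q)) \<cdot> assoc B Q P Q) \<cdot> 
      (n \<star> \<one> Q) \<cdot> (inv2 B (lunit B Q) \<cdot> inv2 B f)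
    = runit B Q' \<cdot> ((\<one> Q' \<star> e) \<cdot> (f \<star> \<one> (P \<otimes> Q))) \<cdot> assoc B Q P Q \<cdot> 
      (n \<star> \<one> Q) \<cdot> (inv2 B (lunit B Q) \<cdot> inv2 B f)"
    by simp
  also have "(\<one> Q' \<star> e) \<cdot> (f \<star> \<one> (P \<otimes> Q)) = (f \<star> \<one> (\<I> a)) \<cdot> (\<one> Q \<star> e)"
    by (simp add: hcomp_vcomp)
  also have "runit B Q' \<cdot> ((f \<star> \<one> (\<I> a)) \<cdot> (\<one> Q \<star> e)) \<cdot> assoc B Q P Q \<cdot> 
      (n \<star> \<one> Q) \<cdot> (inv2 B (lunit B Q) \<cdot> inv2 B f)
    = (runit B Q' \<cdot> (f \<star> \<one> (\<I> a))) \<cdot> (\<one> Q \<star> e) \<cdot> assoc B Q P Q \<cdot> 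
      (n \<star> \<one> Q) \<cdot> (inv2 B (lunit B Q) \<cdot> inv2 B f)"
    by simp
  also have "runit B Q' \<cdot> (f \<star> \<one> (\<I> a)) = f \<cdot> runit B Q"
    using runit_nat[of f] by simp
  also have "(f \<cdot> runit B Q) \<cdot> (\<one> Q \<star> e) \<cdot> assoc B Q P Q \<cdot> 
      (n \<star> \<one> Q) \<cdot> (inv2 B (lunit B Q) \<cdot> inv2 B f)
    = f \<cdot> (runit B Q \<cdot> (\<one> Q \<star> e) \<cdot> assoc B Q P Q \<cdot> (n \<star> \<one> Q) \<cdot> inv2 B (lunit B Q)) \<cdot> inv2 B f"
    by simp
  also have "\<dots> = \<one> Q'"
    by (simp only: z2) simp
  finally have 2: "runit B Q' \<cdot> (\<one> Q' \<star> (e \<cdot> (\<one> P \<star> inv2 B f))) \<cdot> assoc B Q' P Q' \<cdot>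
      (((f \<star> \<one> P) \<cdot> n) \<star> \<one> Q') \<cdot> inv2 B (lunit B Q') = \<one> Q'" .
  show ?thesis
    using 1 2 by (simp add: adjunction_def)
qed

text \<open>The action of \<open>t : \<I> b \<Rightarrow> \<I> b\<close> on 1-cells with target \<open>b\<close>.\<close>

definition scalar ::
  "('o, 'm, 'c, 'x) bicat_scheme \<Rightarrow> 'c \<Rightarrow> 'm \<Rightarrow> 'c" where
  "scalar B t Z = lunit B Z \<cdot> (t \<star> \<one> Z) \<cdot> inv2 B (lunit B Z)"
  for B (structure)

context bicategory
begin

lemma scalar_simps [simp]:
  assumes "Z \<in> Mor B" "t \<in> Cell B" "cdom B t = \<I> (trg B Z)" "ccod B t = \<I> (trg B Z)"
  shows "scalar B t Z \<in> Cell B" "cdom B (scalar B t Z) = Z" "ccod B (scalar B t Z) = Z"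
    "iso2 B t \<Longrightarrow> iso2 B (scalar B t Z)"
  using assms by (simp_all add: scalar_def)

lemma scalar_natural:
  assumes [simp]: "b \<in> Obj B" "t \<in> Cell B" "cdom B t = \<I> b" "ccod B t = \<I> b"
    "f \<in> Cell B" "trg B (cdom B f) = b"
  shows "f \<cdot> scalar B t (cdom B f) = scalar B t (ccod B f) \<cdot> f"
proof -
  let ?Z = "cdom B f" and ?W = "ccod B f"
  have "f \<cdot> scalar B t ?Z = (f \<cdot> lunit B ?Z) \<cdot> (t \<star> \<one> ?Z) \<cdot> inv2 B (lunit B ?Z)"
    by (simp add: scalar_def)
  also have "f \<cdot> lunit B ?Z = lunit B ?W \<cdot> (\<one> (\<I> b) \<star> f)"
    using lunit_nat[of f] by simp
  also have "(lunit B ?W \<cdot> (\<one> (\<I> b) \<star> f)) \<cdot> (t \<star> \<one> ?Z) \<cdot> inv2 B (lunit B ?Z)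
    = lunit B ?W \<cdot> ((\<one> (\<I> b) \<star> f) \<cdot> (t \<star> \<one> ?Z)) \<cdot> inv2 B (lunit B ?Z)"
    by simp
  also have "(\<one> (\<I> b) \<star> f) \<cdot> (t \<star> \<one> ?Z) = (t \<star> \<one> ?W) \<cdot> (\<one> (\<I> b) \<star> f)"
    by (simp add: hcomp_vcomp)
  also have "lunit B ?W \<cdot> ((t \<star> \<one> ?W) \<cdot> (\<one> (\<I> b) \<star> f)) \<cdot> inv2 B (lunit B ?Z)
    = lunit B ?W \<cdot> (t \<star> \<one> ?W) \<cdot> ((\<one> (\<I> b) \<star> f) \<cdot> inv2 B (lunit B ?Z))"
    by simp
  also have "(\<one> (\<I> b) \<star> f) \<cdot> inv2 B (lunit B ?Z) = inv2 B (lunit B ?W) \<cdot> f"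
    using lunit_nat[of f] by (intro iso2_square_inverse) simp_all
  finally show ?thesis
    by (simp add: scalar_def)
qed

lemma scalar_hcomp:
  assumes [simp]: "b \<in> Obj B" "t \<in> Cell B" "cdom B t = \<I> b" "ccod B t = \<I> b"
    "X \<in> Mor B" "trg B X = b" "Y \<in> Mor B" "src B X = trg B Y"
  shows "scalar B t X \<star> \<one> Y = scalar B t (X \<otimes> Y)"
proof -
  let ?a = "assoc B (\<I> b) X Y"
  have l: "lunit B X \<star> \<one> Y = lunit B (X \<otimes> Y) \<cdot> ?a"
    using lunit_hcomp[of X Y] by simp
  have "inv2 B (lunit B X \<star> \<one> Y) = inv2 B (lunit B (X \<otimes> Y) \<cdot> ?a)"
    by (simp only: l)
  then have l': "inv2 B (lunit B X) \<star> \<one> Y = inv2 B ?a \<cdot> inv2 B (lunit B (X \<otimes> Y))"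
    by simp
  have "scalar B t X \<star> \<one> Y
    = lunit B (X \<otimes> Y) \<cdot> (?a \<cdot> ((t \<star> \<one> X) \<star> \<one> Y)) \<cdot> inv2 B ?a \<cdot> inv2 B (lunit B (X \<otimes> Y))"
    by (simp add: scalar_def whisker_vcomp l l')
  also have "?a \<cdot> ((t \<star> \<one> X) \<star> \<one> Y) = (t \<star> \<one> (X \<otimes> Y)) \<cdot> ?a"
    using assoc_nat[of "\<one> Y" "\<one> X" t] by simp
  finally show ?thesis
    by (simp add: scalar_def)
qed

lemma scalar_unit:
  assumes [simp]: "b \<in> Obj B" "t \<in> Cell B" "cdom B t = \<I> b" "ccod B t = \<I> b"
  shows "scalar B t (\<I> b) = t"
proof -
  have "scalar B t (\<I> b) = (runit B (\<I> b) \<cdot> (t \<star> \<one> (\<I> b))) \<cdot> inv2 B (runit B (\<I> b))"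
    by (simp add: scalar_def lunit_eq_runit)
  also have "\<dots> = t"
    using runit_nat[of t] by simp
  finally show ?thesis .
qed

end

text \<open>
  Twisting the unit by a scalar multiplies \<open>e \<cdot> n\<close> by it: the scalar on \<open>X\<close>, whiskered by
  \<open>Y\<close>, is the scalar on \<open>X \<otimes> Y\<close>, which naturality moves through \<open>e\<close> to the unit 1-cell.
\<close>

lemma (in bipairing) scalar_twist:
  assumes [simp]: "t \<in> Cell B" "cdom B t = \<I> b" "ccod B t = \<I> b"
  shows "e \<cdot> (scalar B t X \<star> \<one> Y) \<cdot> n = t \<cdot> (e \<cdot> n)"
proof -
  have "e \<cdot> (scalar B t X \<star> \<one> Y) \<cdot> n = (e \<cdot> scalar B t (X \<otimes> Y)) \<cdot> n"
    using scalar_hcomp[of b t X Y] by simp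
  also have "e \<cdot> scalar B t (X \<otimes> Y) = t \<cdot> e"
    using scalar_natural[of b t e] by (simp add: scalar_unit)
  finally show ?thesis by simp
qed

section \<open>Algebras and Frobenius algebras from adjunctions\<close>

theorem proposition4p3:
  fixes B :: "('o, 'm, 'c, 'x) bicat_scheme" (structure)
    and a b :: 'o and X Y :: 'm
  assumes "bicategory B"
    and "a \<in> Obj B" and "b \<in> Obj B"
    and "X \<in> hom B a b" and "Y \<in> hom B b a"
  shows
    "(\<forall>\<epsilon>t \<eta>t. adjunction B b a X Y \<epsilon>t \<eta>t \<longrightarrow>
        algebra_on B a (Y \<otimes> X) (insert_counit B X Y \<epsilon>t) \<eta>t \<and>
        coalgebra_on B b (X \<otimes> Y) (insert_unit B X Y \<eta>t) \<epsilon>t)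
     \<and>
     (\<forall>\<epsilon> \<eta> \<epsilon>t \<eta>t. adjunction B a b Y X \<epsilon> \<eta> \<and> adjunction B b a X Y \<epsilon>t \<eta>t \<longrightarrow>
        frobenius_algebra B a (Y \<otimes> X)
          (insert_counit B X Y \<epsilon>t) \<eta>t (insert_unit B Y X \<eta>) \<epsilon> \<and>
        (\<epsilon>t \<cdot> \<eta> = \<one> (\<I> b) \<longrightarrow>
           separable B (Y \<otimes> X) (insert_counit B X Y \<epsilon>t) (insert_unit B Y X \<eta>)))
     \<and>
     (\<forall>\<epsilon> \<eta> \<epsilon>t \<eta>t. adjunction B a b Y X \<epsilon> \<eta> \<and> adjunction B b a X Y \<epsilon>t \<eta>t \<and>
        iso2 B (\<epsilon>t \<cdot> \<eta>) \<longrightarrow>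
        (let \<phi> = lunit B X \<cdot> (inv2 B (\<epsilon>t \<cdot> \<eta>) \<star> \<one> X) \<cdot> inv2 B (lunit B X);
             \<epsilon>' = \<epsilon> \<cdot> (\<one> Y \<star> inv2 B \<phi>);
             \<eta>' = (\<phi> \<star> \<one> Y) \<cdot> \<eta>
         in \<phi> \<in> cells B X X \<and> iso2 B \<phi> \<and>
            adjunction B a b Y X \<epsilon>' \<eta>' \<and>
            frobenius_algebra B a (Y \<otimes> X)
              (insert_counit B X Y \<epsilon>t) \<eta>t (insert_unit B Y X \<eta>') \<epsilon>' \<and>
            separable B (Y \<otimes> X) (insert_counit B X Y \<epsilon>t) (insert_unit B Y X \<eta>')))"
proof (intro conjI allI impI)
  interpret bicategory B by fact
  {
    fix \<epsilon>t \<eta>t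
    assume adj: "adjunction B b a X Y \<epsilon>t \<eta>t"
    show "algebra_on B a (Y \<otimes> X) (insert_counit B X Y \<epsilon>t) \<eta>t"
      by (rule algebra_on_of_adjunction[OF adj])
    show "coalgebra_on B b (X \<otimes> Y) (insert_unit B X Y \<eta>t) \<epsilon>t"
      by (rule coalgebra_on_of_adjunction[OF adj])
  }
  {
    fix \<epsilon> \<eta> \<epsilon>t \<eta>t
    assume adj: "adjunction B a b Y X \<epsilon> \<eta> \<and> adjunction B b a X Y \<epsilon>t \<eta>t"
    show "frobenius_algebra B a (Y \<otimes> X)
        (insert_counit B X Y \<epsilon>t) \<eta>t (insert_unit B Y X \<eta>) \<epsilon>"
      using adj frobenius_algebra_of_adjunctions by blast
    show "separable B (Y \<otimes> X) (insert_counit B X Y \<epsilon>t) (insert_unit B Y X \<eta>)"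
      if "\<epsilon>t \<cdot> \<eta> = \<one> (\<I> b)"
      using adj that by (blast intro: bipairing.separable_insert[OF bipairing_of_adjunctions])
  }
  fix \<epsilon> \<eta> \<epsilon>t \<eta>t
  assume asm: "adjunction B a b Y X \<epsilon> \<eta> \<and> adjunction B b a X Y \<epsilon>t \<eta>t \<and> iso2 B (\<epsilon>t \<cdot> \<eta>)"
  then have adj: "adjunction B a b Y X \<epsilon> \<eta>" and adjt: "adjunction B b a X Y \<epsilon>t \<eta>t"
    and s [simp]: "iso2 B (\<epsilon>t \<cdot> \<eta>)" by auto
  interpret bipairing B a b X Y \<epsilon>t \<eta> by (rule bipairing_of_adjunctions[OF adj adjt])
  define t where "t = inv2 B (\<epsilon>t \<cdot> \<eta>)"
  have t [simp]: "t \<in> Cell B" "cdom B t = \<I> b" "ccod B t = \<I> b" "iso2 B t"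
    and ts: "t \<cdot> (\<epsilon>t \<cdot> \<eta>) = \<one> (\<I> b)"
    by (simp_all add: t_def)
  define \<phi> where "\<phi> = scalar B t X"
  have \<phi>: "\<phi> \<in> cells B X X" "iso2 B \<phi>"
    by (auto simp: \<phi>_def)
  have adj': "adjunction B a b Y X (\<epsilon> \<cdot> (\<one> Y \<star> inv2 B \<phi>)) ((\<phi> \<star> \<one> Y) \<cdot> \<eta>)"
    using \<phi> by - (rule adjunction_transport[OF adj], auto simp: cells_def)
  have "\<epsilon>t \<cdot> (\<phi> \<star> \<one> Y) \<cdot> \<eta> = \<one> (\<I> b)"
    by (simp only: \<phi>_def scalar_twist[OF t(1-3)] ts)
  then have "separable B (Y \<otimes> X) (insert_counit B X Y \<epsilon>t) (insert_unit B Y X ((\<phi> \<star> \<one> Y) \<cdot> \<eta>))"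
    by (rule bipairing.separable_insert[OF bipairing_of_adjunctions[OF adj' adjt]])
  then show "let \<phi> = lunit B X \<cdot> (inv2 B (\<epsilon>t \<cdot> \<eta>) \<star> \<one> X) \<cdot> inv2 B (lunit B X);
             \<epsilon>' = \<epsilon> \<cdot> (\<one> Y \<star> inv2 B \<phi>);
             \<eta>' = (\<phi> \<star> \<one> Y) \<cdot> \<eta>
         in \<phi> \<in> cells B X X \<and> iso2 B \<phi> \<and>
            adjunction B a b Y X \<epsilon>' \<eta>' \<and>
            frobenius_algebra B a (Y \<otimes> X)
              (insert_counit B X Y \<epsilon>t) \<eta>t (insert_unit B Y X \<eta>') \<epsilon>' \<and>
            separable B (Y \<otimes> X) (insert_counit B X Y \<epsilon>t) (insert_unit B Y X \<eta>')"
    using \<phi> adj' frobenius_algebra_of_adjunctions[OF adj' adjt]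
    unfolding Let_def t_def[symmetric] scalar_def[symmetric] \<phi>_def[symmetric] by blast
qed

end
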